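(* There exists an integer $N$ such that for all $n \ge N$ and all nonnegative integers $k \neq 4$, we have $P_{n,M}(4) > P_{n,M}(k)$, where $P_{n,M}(k) := P(2n-1-|S-S| = k)$ for $S$ a uniformly random subset of $[n]=\{0,1,\dots,n-1\}$.
   Context: For a positive integer $n$, $[n] := \{0,1,\dots,n-1\}$, and $S$ is chosen uniformly at random among all $2^n$ subsets of $[n]$. The difference set is $S-S := \{x-y : x,y \in S\}$. Note $|S-S| \le 2n-1$, so $2n-1-|S-S|$ is the number of elements of $\{-(n-1),\dots,n-1\}$ missing from $S-S$. *)

theory Defs
  imports "HOL-Probability.Probability"
begin

definition difference_set :: "int set \<Rightarrow> int set" where
  "difference_set S = {x - y | x y. x \<in> S \<and> y \<in> S}"

(* The count 2n - 1 - |S - S| is taken in int, so that no truncated subtraction occurs. *)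
definition P_missing :: "nat \<Rightarrow> nat \<Rightarrow> real" where
  "P_missing n k = measure_pmf.prob (pmf_of_set (Pow {0..<int n}))
     {S. 2 * int n - 1 - int (card (difference_set S)) = int k}"

end

theory Submission
  imports Defs
begin

text \<open>
  For large \<open>n\<close> every difference of size at most about \<open>n/2\<close> occurs in \<open>S - S\<close> with probability
  exponentially close to \<open>1\<close>. The difference \<open>n - 1 - j\<close> with \<open>j < n/2\<close> is missing iff
  \<open>j \<notin> A + B\<close>, where \<open>A\<close> and \<open>B\<close> are the traces of \<open>S\<close> on its left half and, mirrored, on its
  right half; these are independent and uniform. Missing differences come in pairs, so up to
  an exponentially small error \<open>P_missing n (2 k)\<close> is the probability \<open>p k\<close> that a sum \<open>A + B\<close>
  of two random sets of naturals misses exactly \<open>k\<close> numbers.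

  Let \<open>q k\<close> be the same probability conditioned on \<open>0 \<in> A\<close> and \<open>0 \<in> B\<close>. Shifting a set that does
  not contain \<open>0\<close> gives \<open>p k - p (k - 1) = (q k - p (k - 2)) / 4\<close>. Hence \<open>p 0 \<le> p 1\<close>, further
  \<open>p 1 < p 2\<close> iff \<open>q 0 < 4 q 2\<close>, and telescoping together with \<open>\<Sum> q = 1\<close> shows \<open>p k < p 2\<close>
  for all \<open>k \<ge> 3\<close> as soon as \<open>4 < 5 (q 0 + q 1) + 4 q 2\<close>.

  Both inequalities on \<open>q\<close> are numerical (the margin of the first one is about \<open>0.05\<close>). They are
  certified by a decision tree that reveals the bits of \<open>A\<close> and \<open>B\<close> only as far as needed to decide
  whether \<open>1, 2, 3, \<dots>\<close> belong to \<open>A + B\<close>. If the bits are independent with probabilities \<open>a\<close>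
  and \<open>b\<close>, then \<open>k\<close> is missing with probability exactly \<open>\<Prod>i\<le>k. 1 - a i * b (k - i)\<close>, which
  controls the undecided numbers at the leaves.
\<close>

subsection \<open>Sums of two random sets with independent bits\<close>

definition weight :: "nat \<Rightarrow> (nat \<Rightarrow> real) \<Rightarrow> nat set \<Rightarrow> real" where
  "weight h a A = (\<Prod>i<h. if i \<in> A then a i else 1 - a i)"

definition expect :: "nat \<Rightarrow> (nat \<Rightarrow> real) \<Rightarrow> (nat \<Rightarrow> real) \<Rightarrow> (nat set \<Rightarrow> nat set \<Rightarrow> real) \<Rightarrow> real" where
  "expect h a b F = (\<Sum>A\<in>Pow {..<h}. \<Sum>B\<in>Pow {..<h}. weight h a A * weight h b B * F A B)"

definition missing :: "nat \<Rightarrow> nat set \<Rightarrow> nat set \<Rightarrow> nat set" where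
  "missing h A B = {j. j < h \<and> (\<forall>i\<le>j. \<not> (i \<in> A \<and> j - i \<in> B))}"

lemma sum_Pow_lessThan_Suc:
  fixes F :: "nat set \<Rightarrow> 'a::comm_monoid_add"
  shows "(\<Sum>A\<in>Pow {..<Suc h}. F A) = (\<Sum>A\<in>Pow {..<h}. F A + F (insert h A))"
proof -
  have "Pow {..<Suc h} = Pow {..<h} \<union> insert h ` Pow {..<h}"
    by (simp add: lessThan_Suc Pow_insert)
  moreover have "Pow {..<h} \<inter> insert h ` Pow {..<h} = {}" by auto
  moreover have "inj_on (insert h) (Pow {..<h})"
    by (rule inj_onI) (metis PowD insert_ident lessThan_iff less_irrefl subsetD)
  ultimately show ?thesis
    by (simp add: sum.union_disjoint sum.reindex sum.distrib)
qed

text \<open>Distributivity: the set \<open>A\<close> records the factors from which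
  \<open>x i\<close> is chosen.\<close>

lemma sum_Pow_prod_if:
  fixes x y :: "nat \<Rightarrow> real"
  shows "(\<Sum>A\<in>Pow {..<h}. \<Prod>i<h. if i \<in> A then x i else y i) = (\<Prod>i<h. x i + y i)"
proof (induction h)
  case (Suc h)
  have eq: "(\<Prod>i<h. if i \<in> insert h A then x i else y i) = (\<Prod>i<h. if i \<in> A then x i else y i)" for A
    by (rule prod.cong) auto
  have "(\<Sum>A\<in>Pow {..<Suc h}. \<Prod>i<Suc h. if i \<in> A then x i else y i)
      = (\<Sum>A\<in>Pow {..<h}. (\<Prod>i<h. if i \<in> A then x i else y i) * (x h + y h))"
    unfolding sum_Pow_lessThan_Suc
    by (rule sum.cong) (auto simp: eq algebra_simps)
  then show ?case using Suc by (simp flip: sum_distrib_right)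
qed simp

lemma sum_weight: "(\<Sum>A\<in>Pow {..<h}. weight h a A) = 1"
  unfolding weight_def by (subst sum_Pow_prod_if) simp

lemma weight_nonneg:
  assumes "\<And>i. a i \<in> {0..1}"
  shows "0 \<le> weight h a A"
  unfolding weight_def using assms by (intro prod_nonneg) (auto simp: le_diff_eq)

lemma weight_nonzeroD:
  assumes "weight h a A \<noteq> 0" "i < h"
  shows "a i = 0 \<Longrightarrow> i \<notin> A" "a i = 1 \<Longrightarrow> i \<in> A"
  using assms unfolding weight_def by (auto split: if_splits)

text \<open>\<open>weight\<close> is affine in each single bit probability, so its value at
  \<open>1/2\<close> is the mean of those at \<open>0\<close> and \<open>1\<close>.\<close>

lemma weight_split:
  assumes "a i = 1/2" "i < h"
  shows "weight h a A = (weight h (a(i := 0)) A + weight h (a(i := 1)) A) / 2"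
proof -
  define R where "R = (\<Prod>k\<in>{..<h} - {i}. if k \<in> A then a k else 1 - a k)"
  have *: "weight h (a(i := v)) A = (if i \<in> A then v else 1 - v) * R" for v
  proof -
    have "weight h (a(i := v)) A = (if i \<in> A then v else 1 - v) *
        (\<Prod>k\<in>{..<h} - {i}. if k \<in> A then (a(i := v)) k else 1 - (a(i := v)) k)"
      unfolding weight_def using assms(2) by (subst prod.remove[of _ i]) auto
    also have "(\<Prod>k\<in>{..<h} - {i}. if k \<in> A then (a(i := v)) k else 1 - (a(i := v)) k) = R"
      unfolding R_def by (rule prod.cong) auto
    finally show ?thesis .
  qed
  have "a = a(i := 1/2)" using assms(1) by auto
  then show ?thesis using *[of 0] *[of 1] *[of "1/2"] by (auto split: if_splits)
qed

lemma expect_split_left: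
  assumes "a i = 1/2" "i < h"
  shows "expect h a b F = (expect h (a(i := 0)) b F + expect h (a(i := 1)) b F) / 2"
  unfolding expect_def weight_split[of a i, OF assms] sum.distrib[symmetric] sum_divide_distrib
  by (intro sum.cong) (auto simp: field_simps)

lemma missing_commute: "missing h A B = missing h B A"
proof -
  have "j \<in> missing h B A" if "j \<in> missing h A B" for j A B
    unfolding missing_def
  proof (intro CollectI conjI allI impI notI)
    show "j < h" using that unfolding missing_def by simp
    fix i assume "i \<le> j" "i \<in> B \<and> j - i \<in> A"
    then show False
      using that unfolding missing_def by (auto dest!: spec[of _ "j - i"])
  qed
  then show ?thesis by blast
qed

lemma expect_swap: "expect h a b F = expect h b a (\<lambda>A B. F B A)"
  unfolding expect_def by (subst sum.swap) (simp add: mult.commute mult.left_commute)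

lemma expect_split_right:
  assumes "b i = 1/2" "i < h"
  shows "expect h a b F = (expect h a (b(i := 0)) F + expect h a (b(i := 1)) F) / 2"
  using expect_split_left[of b i, OF assms, of a "\<lambda>A B. F B A"] by (simp add: expect_swap[of _ a])

lemma expect_const: "expect h a b (\<lambda>_ _. c) = c"
  unfolding expect_def by (simp add: sum_weight flip: sum_distrib_left sum_distrib_right)

lemma expect_add: "expect h a b (\<lambda>A B. F A B + G A B) = expect h a b F + expect h a b G"
  unfolding expect_def by (simp add: distrib_left sum.distrib)

lemma expect_cmult: "expect h a b (\<lambda>A B. c * F A B) = c * expect h a b F"
  unfolding expect_def by (simp add: sum_distrib_left mult_ac)

lemma expect_sum: "expect h a b (\<lambda>A B. \<Sum>k\<in>K. F k A B) = (\<Sum>k\<in>K. expect h a b (F k))"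
  by (induction K rule: infinite_finite_induct) (auto simp: expect_const expect_add)

text \<open>The comparison is asked for on the support only, so that bits already revealed may be
  used.\<close>

lemma expect_mono:
  assumes "\<And>i. a i \<in> {0..1}" "\<And>i. b i \<in> {0..1}"
    and "\<And>A B. weight h a A \<noteq> 0 \<Longrightarrow> weight h b B \<noteq> 0 \<Longrightarrow> A \<subseteq> {..<h} \<Longrightarrow> B \<subseteq> {..<h} \<Longrightarrow> F A B \<le> G A B"
  shows "expect h a b F \<le> expect h a b G"
  unfolding expect_def
proof (intro sum_mono)
  fix A B assume AB: "A \<in> Pow {..<h}" "B \<in> Pow {..<h}"
  show "weight h a A * weight h b B * F A B \<le> weight h a A * weight h b B * G A B"
  proof (cases "weight h a A = 0 \<or> weight h b B = 0")
    case False
    then have "F A B \<le> G A B" using assms(3) AB by auto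
    then show ?thesis
      using assms(1,2) by (intro mult_left_mono mult_nonneg_nonneg weight_nonneg) auto
  qed auto
qed

text \<open>The pairs \<open>(i, j - i)\<close> use each bit of \<open>A\<close> and of
  \<open>B\<close> at most once, so the events that both bits of a pair are present are independent.
  The computation sums over \<open>B\<close> first and then over \<open>A\<close>.\<close>

lemma expect_missing:
  assumes "j < h"
  shows "expect h a b (\<lambda>A B. of_bool (j \<in> missing h A B)) = (\<Prod>i\<le>j. 1 - a i * b (j - i))"
proof -
  have le: "(\<Prod>k<h. if k \<le> j then g k else 1) = (\<Prod>k\<le>j. g k)" for g :: "nat \<Rightarrow> real"
    using assms by (intro prod.mono_neutral_cong_right) auto
  have inner: "(\<Sum>B\<in>Pow {..<h}. weight h b B * of_bool (j \<in> missing h A B))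
      = (\<Prod>i<h. if i \<in> A then (if i \<le> j then 1 - b (j - i) else 1) else 1)" for A
  proof -
    \<comment> \<open>An element of \<open>B\<close> that \<open>A\<close> forbids gets the factor
      \<open>0\<close>, so the product over the bits absorbs the indicator.\<close>
    define x where "x k = (if k \<le> j \<and> j - k \<in> A then 0 else b k)" for k
    have "weight h b B * of_bool (j \<in> missing h A B) = (\<Prod>k<h. if k \<in> B then x k else 1 - b k)"
      if "B \<subseteq> {..<h}" for B
    proof (cases "j \<in> missing h A B")
      case True
      then have "x k = b k" if "k \<in> B" for k
        using that unfolding missing_def x_def by (auto dest!: spec[of _ "j - k"])
      then show ?thesis using True unfolding weight_def by (auto intro!: prod.cong)
    next
      case False
      then obtain i where i: "i \<le> j" "i \<in> A" "j - i \<in> B"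
        using assms unfolding missing_def by auto
      then have "x (j - i) = 0" unfolding x_def by auto
      then have "(\<Prod>k<h. if k \<in> B then x k else 1 - b k) = 0"
        using i assms by (intro prod_zero) (auto intro!: bexI[of _ "j - i"])
      then show ?thesis using False by simp
    qed
    then have "(\<Sum>B\<in>Pow {..<h}. weight h b B * of_bool (j \<in> missing h A B))
        = (\<Sum>B\<in>Pow {..<h}. \<Prod>k<h. if k \<in> B then x k else 1 - b k)"
      by (intro sum.cong) auto
    also have "\<dots> = (\<Prod>k<h. x k + (1 - b k))" by (rule sum_Pow_prod_if)
    also have "\<dots> = (\<Prod>k<h. if k \<le> j then (if j - k \<in> A then 1 - b k else 1) else 1)"
      by (intro prod.cong) (auto simp: x_def)
    also have "\<dots> = (\<Prod>k\<le>j. if j - k \<in> A then 1 - b k else 1)" by (rule le)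
    also have "\<dots> = (\<Prod>i\<le>j. if i \<in> A then 1 - b (j - i) else 1)"
      by (rule prod.reindex_bij_witness[of _ "\<lambda>i. j - i" "\<lambda>i. j - i"]) auto
    also have "\<dots> = (\<Prod>i<h. if i \<le> j then if i \<in> A then 1 - b (j - i) else 1 else 1)"
      by (rule le[symmetric])
    also have "\<dots> = (\<Prod>i<h. if i \<in> A then (if i \<le> j then 1 - b (j - i) else 1) else 1)"
      by (intro prod.cong) auto
    finally show ?thesis .
  qed
  have "expect h a b (\<lambda>A B. of_bool (j \<in> missing h A B))
      = (\<Sum>A\<in>Pow {..<h}. weight h a A * (\<Prod>i<h. if i \<in> A then (if i \<le> j then 1 - b (j - i) else 1) else 1))"
    unfolding expect_def by (simp add: mult.assoc inner flip: sum_distrib_left)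
  also have "\<dots> = (\<Sum>A\<in>Pow {..<h}. \<Prod>i<h. if i \<in> A then a i * (if i \<le> j then 1 - b (j - i) else 1) else 1 - a i)"
    unfolding weight_def by (simp flip: prod.distrib cong: prod.cong)
       (intro sum.cong prod.cong; auto)
  also have "\<dots> = (\<Prod>i<h. a i * (if i \<le> j then 1 - b (j - i) else 1) + (1 - a i))"
    by (rule sum_Pow_prod_if)
  also have "\<dots> = (\<Prod>i<h. if i \<le> j then 1 - a i * b (j - i) else 1)"
    by (intro prod.cong) (auto simp: algebra_simps)
  also have "\<dots> = (\<Prod>i\<le>j. 1 - a i * b (j - i))" by (rule le)
  finally show ?thesis .
qed

subsection \<open>The decision tree\<close>

text \<open>\<open>Open\<close> marks a fair bit that has not been revealed.\<close>

datatype bit = Absent | Open | Present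

fun bit_prob :: "bit \<Rightarrow> real" where
  "bit_prob Absent = 0" | "bit_prob Open = 1/2" | "bit_prob Present = 1"

definition prob_of :: "bit list \<Rightarrow> nat \<Rightarrow> real" where
  "prob_of xs i = (if i < length xs then bit_prob (xs ! i) else 1/2)"

text \<open>
  Probabilities are scaled by powers of two and rounded up to elements of \<^typ>\<open>num\<close>, for which
  halving and adding take few rewriting steps.
\<close>

fun halve :: "num \<Rightarrow> num" where
  "halve num.One = num.One"
| "halve (num.Bit0 n) = n"
| "halve (num.Bit1 n) = Num.inc n"

text \<open>The factor, rounded up, is \<open>1 - bit_prob x / 2\<close>: the bit \<open>x\<close>
  has a fair coin as its partner.\<close>

fun decay :: "bit \<Rightarrow> num \<Rightarrow> num" where
  "decay Absent v = v"
| "decay Present v = halve v"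
| "decay Open v = (let m = halve v in m + halve m)"

fun pair_decay :: "bit \<Rightarrow> bit \<Rightarrow> num \<Rightarrow> num" where
  "pair_decay Absent y v = v"
| "pair_decay Open y v = decay y v"
| "pair_decay Present y v = (case y of Absent \<Rightarrow> v | _ \<Rightarrow> halve v)"

fun covered :: "bit list \<Rightarrow> bit list \<Rightarrow> bool" where
  "covered (Present # xs) (Present # ys) = True"
| "covered (_ # xs) (_ # ys) = covered xs ys"
| "covered _ _ = False"

text \<open>If the first list starts with bit \<open>s\<close> of \<open>A\<close> and the second
  runs from bit \<open>j\<close> of \<open>B\<close> down to bit \<open>0\<close>, equal positions
  have index sum \<open>j + s\<close>. Surplus entries have no listed partner.\<close>

fun list_decay :: "num \<Rightarrow> bit list \<Rightarrow> bit list \<Rightarrow> num" where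
  "list_decay v (x # xs) (y # ys) = list_decay (pair_decay x y v) xs ys"
| "list_decay v _ _ = v"

text \<open>
  From here on \<open>xs\<close> lists the bits \<open>0, \<dots>, j\<close> of \<open>A\<close> and \<open>ys\<close> the bits \<open>j, \<dots>, 0\<close> of \<open>B\<close>, so that
  entries at equal positions have indices with sum \<open>j\<close>; all later bits are open. The bound is for
  the expected number of missing \<open>k \<ge> j\<close>, the factor \<open>4\<close> at the end being the sum of the geometric
  series for \<open>k > 2 j\<close>.
\<close>

fun miss_bound :: "num \<Rightarrow> bit list \<Rightarrow> bit list \<Rightarrow> bit list \<Rightarrow> num" where
  "miss_bound v (x # xs) ys (b # bs) =
     (let u = miss_bound (decay x (decay b v)) xs ys bs
      in if covered (x # xs) ys then u else list_decay v (x # xs) ys + u)"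
| "miss_bound v _ _ _ = num.Bit0 (num.Bit0 v)"

text \<open>
  The next open bit that matters for \<open>j\<close>, in \<open>A\<close> if the flag is set and otherwise in \<open>B\<close>; only
  meaningful if \<open>j\<close> is not yet covered.
\<close>

fun query :: "bit list \<Rightarrow> bit list \<Rightarrow> (bool \<times> nat) option" where
  "query (Absent # xs) (y # ys) = map_option (apsnd Suc) (query xs ys)"
| "query (x # xs) (Absent # ys) = map_option (apsnd Suc) (query xs ys)"
| "query (x # xs) (Open # ys) = Some (False, 0)"
| "query (x # xs) (Present # ys) = Some (True, 0)"
| "query _ _ = None"

text \<open>
  If \<open>l c = (g, s)\<close>, then \<open>g - s y\<close> is a minorant of \<open>f (c + y)\<close> in the number \<open>y \<ge> 0\<close> of further missing
  elements, where \<open>f\<close> is the function whose expectation is to be bounded.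
\<close>

definition leaf :: "(nat \<Rightarrow> int \<times> int) \<Rightarrow> nat \<Rightarrow> num \<Rightarrow> bit list \<Rightarrow> bit list \<Rightarrow> int" where
  "leaf l c w xs ys = (case l c of (g, s) \<Rightarrow>
     if s = 0 then g * numeral w
     else g * numeral w - s * numeral (miss_bound w xs ys (rev ys)))"

text \<open>
  The first argument of type \<^typ>\<open>nat\<close> is a budget. Charging \<open>1\<close> for a bit found absent and \<open>3\<close> for a bit
  found present or for a decided number makes the tree deep where few elements are known; these
  weights were found by experiment.
\<close>

fun lower_bound :: "(nat \<Rightarrow> int \<times> int) \<Rightarrow> nat \<Rightarrow> nat \<Rightarrow> num \<Rightarrow> bit list \<Rightarrow> bit list \<Rightarrow> int" where
  "lower_bound l (Suc (Suc (Suc t))) c (num.Bit0 w) xs ys =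
     (if 2 < c then leaf l c (num.Bit0 w) xs ys
      else if covered xs ys then lower_bound l t c (num.Bit0 w) (xs @ [Open]) (Open # ys)
      else case query xs ys of
        None \<Rightarrow> lower_bound l t (Suc c) (num.Bit0 w) (xs @ [Open]) (Open # ys)
      | Some (True, i) \<Rightarrow>
          lower_bound l (Suc (Suc t)) c w (xs[i := Absent]) ys + lower_bound l t c w (xs[i := Present]) ys
      | Some (False, i) \<Rightarrow>
          lower_bound l (Suc (Suc t)) c w xs (ys[i := Absent]) + lower_bound l t c w xs (ys[i := Present]))"
| "lower_bound l _ c w xs ys = leaf l c w xs ys"

section \<open>Rounded arithmetic on probabilities\<close>

definition nval :: "num \<Rightarrow> real" where
  "nval v = numeral v"

lemma nval_simps [simp]:
  "nval num.One = 1" "nval (num.Bit0 v) = 2 * nval v" "nval (num.Bit1 v) = 2 * nval v + 1"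
  "nval (u + v) = nval u + nval v" "nval (Num.inc v) = nval v + 1" "0 < nval v" "0 \<le> nval v"
proof -
  show "nval (num.Bit0 v) = 2 * nval v" unfolding nval_def by (metis numeral_Bit0 mult_2)
  show "nval (num.Bit1 v) = 2 * nval v + 1" unfolding nval_def by (metis numeral_Bit1 mult_2)
qed (simp_all add: nval_def numeral_inc)

lemma nval_halve: "nval v / 2 \<le> nval (halve v)"
  by (cases v) simp_all

lemma nval_decay: "nval v * (1 - bit_prob x / 2) \<le> nval (decay x v)"
  using nval_halve[of v] nval_halve[of "halve v"] by (cases x) (simp_all add: Let_def)

lemma nval_pair_decay: "nval v * (1 - bit_prob x * bit_prob y) \<le> nval (pair_decay x y v)"
  using nval_halve[of v] nval_decay[of v y] by (cases x; cases y) simp_all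

lemma bit_prob_bounds: "0 \<le> bit_prob x" "bit_prob x \<le> 1" "bit_prob x \<in> {0..1}"
  by (cases x; simp)+

lemma nval_list_decay:
  "nval v * (\<Prod>i<min (length xs) (length ys). 1 - bit_prob (xs ! i) * bit_prob (ys ! i))
     \<le> nval (list_decay v xs ys)"
proof (induction v xs ys rule: list_decay.induct)
  case (1 v x xs y ys)
  let ?P = "\<Prod>i<min (length xs) (length ys). 1 - bit_prob (xs ! i) * bit_prob (ys ! i)"
  have "0 \<le> ?P"
    by (intro prod_nonneg) (simp add: bit_prob_bounds mult_le_one)
  then have "nval v * (1 - bit_prob x * bit_prob y) * ?P \<le> nval (pair_decay x y v) * ?P"
    by (intro mult_right_mono nval_pair_decay)
  also have "\<dots> \<le> nval (list_decay v (x # xs) (y # ys))" using 1 by simp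
  finally show ?case
    by (simp add: prod.lessThan_Suc_shift min_Suc_Suc mult.assoc del: prod.lessThan_Suc right_diff_distrib_numeral)
qed simp_all

lemma covered_iff:
  "covered xs ys \<longleftrightarrow> (\<exists>i<min (length xs) (length ys). xs ! i = Present \<and> ys ! i = Present)"
  by (induction xs ys rule: covered.induct) (simp_all add: Ex_less_Suc2 del: split_paired_Ex)

lemma prob_of_bounds: "prob_of xs i \<in> {0..1}"
  using bit_prob_bounds by (auto simp: prob_of_def)

lemma prob_of_snoc: "prob_of (xs @ [Open]) = prob_of xs"
  by (auto simp: prob_of_def nth_append fun_eq_iff less_Suc_eq)

lemma prob_of_update: "i < length xs \<Longrightarrow> prob_of (xs[i := v]) = (prob_of xs)(i := bit_prob v)"
  by (auto simp: prob_of_def fun_eq_iff)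

section \<open>Expected number of missing elements among the undecided ones\<close>

definition miss_prob :: "(nat \<Rightarrow> real) \<Rightarrow> (nat \<Rightarrow> real) \<Rightarrow> nat \<Rightarrow> real" where
  "miss_prob a b k = (\<Prod>i\<le>k. 1 - a i * b (k - i))"

lemma miss_prob_nonneg:
  assumes "\<And>i. a i \<in> {0..1}" "\<And>i. b i \<in> {0..1}"
  shows "0 \<le> miss_prob a b k"
  unfolding miss_prob_def using assms by (intro prod_nonneg) (simp add: mult_le_one)

text \<open>Contribution of the pairs in which one index is below \<open>s\<close> and the partner
  is a bit beyond the lists, hence a fair coin.\<close>

definition head_prob :: "(nat \<Rightarrow> real) \<Rightarrow> (nat \<Rightarrow> real) \<Rightarrow> nat \<Rightarrow> real" where
  "head_prob a b s = (\<Prod>i<s. (1 - a i / 2) * (1 - b i / 2))"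

lemma prod_three_blocks:
  fixes g :: "nat \<Rightarrow> real"
  shows "(\<Prod>i<s + m + r. g i) = (\<Prod>i<s. g i) * (\<Prod>i<m. g (s + i)) * (\<Prod>i<r. g (s + m + i))"
  by (induction r) (simp_all, induction m, simp_all add: mult.assoc)

text \<open>Among the pairs with index sum \<open>n - 1 + s\<close>, the first \<open>s\<close> and
  the last \<open>s\<close> have one bit beyond the lists; the \<open>n - s\<close> in between are
  listed on both sides.\<close>

lemma miss_prob_mid:
  assumes "length xs = n" "length ys = n" "s < n"
  shows "miss_prob (prob_of xs) (prob_of (rev ys)) (n - 1 + s) = head_prob (prob_of xs) (prob_of (rev ys)) s *
    (\<Prod>i<n - s. 1 - bit_prob (xs ! (s + i)) * bit_prob (ys ! i))"
proof -
  let ?a = "prob_of xs" and ?b = "prob_of (rev ys)"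
  define g where "g i = 1 - ?a i * ?b (n - 1 + s - i)" for i
  have "{..n - 1 + s} = {..<s + (n - s) + s}" using assms by auto
  then have "miss_prob ?a ?b (n - 1 + s) = (\<Prod>i<s + (n - s) + s. g i)"
    unfolding miss_prob_def g_def by simp
  also have "\<dots> = (\<Prod>i<s. g i) * (\<Prod>i<n - s. g (s + i)) * (\<Prod>i<s. g (s + (n - s) + i))"
    by (rule prod_three_blocks)
  also have "(\<Prod>i<s. g i) = (\<Prod>i<s. 1 - ?a i / 2)"
    using assms by (intro prod.cong) (auto simp: g_def prob_of_def[of "rev ys"])
  also have "(\<Prod>i<n - s. g (s + i)) = (\<Prod>i<n - s. 1 - bit_prob (xs ! (s + i)) * bit_prob (ys ! i))"
    using assms by (intro prod.cong) (auto simp: g_def prob_of_def rev_nth)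
  also have "(\<Prod>i<s. g (s + (n - s) + i)) = (\<Prod>i<s. 1 - ?b (s - Suc i) / 2)"
    using assms by (intro prod.cong) (auto simp: g_def prob_of_def[of xs])
  also have "\<dots> = (\<Prod>i<s. 1 - ?b i / 2)" by (rule prod.nat_diff_reindex)
  finally show ?thesis by (simp add: head_prob_def prod.distrib)
qed

text \<open>Here no pair is listed on both sides: \<open>n\<close> pairs at either end have one
  listed bit, and the \<open>r\<close> in the middle consist of two fair coins.\<close>

lemma miss_prob_tail:
  assumes "length xs = n" "length ys = n" "0 < n"
  shows "miss_prob (prob_of xs) (prob_of (rev ys)) (n - 1 + n + r) = head_prob (prob_of xs) (prob_of (rev ys)) n * (3/4) ^ r"
proof -
  let ?a = "prob_of xs" and ?b = "prob_of (rev ys)"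
  define g where "g i = 1 - ?a i * ?b (n - 1 + n + r - i)" for i
  have "{..n - 1 + n + r} = {..<n + r + n}" using assms(3) by (intro set_eqI) (simp; arith)
  then have "miss_prob ?a ?b (n - 1 + n + r) = (\<Prod>i<n + r + n. g i)"
    unfolding miss_prob_def g_def by simp
  also have "\<dots> = (\<Prod>i<n. g i) * (\<Prod>i<r. g (n + i)) * (\<Prod>i<n. g (n + r + i))"
    by (rule prod_three_blocks)
  also have "(\<Prod>i<n. g i) = (\<Prod>i<n. 1 - ?a i / 2)"
    using assms by (intro prod.cong) (auto simp: g_def prob_of_def[of "rev ys"])
  also have "(\<Prod>i<r. g (n + i)) = (\<Prod>i<r. 3/4)"
    using assms by (intro prod.cong) (auto simp: g_def prob_of_def)
  also have "(\<Prod>i<n. g (n + r + i)) = (\<Prod>i<n. 1 - ?b (n - Suc i) / 2)"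
    using assms by (intro prod.cong) (auto simp: g_def prob_of_def[of xs])
  also have "\<dots> = (\<Prod>i<n. 1 - ?b i / 2)" by (rule prod.nat_diff_reindex)
  finally show ?thesis by (simp add: head_prob_def prod.distrib)
qed

lemma sum_geometric_le: "(\<Sum>r<m. (3/4) ^ r) \<le> (4::real)"
  using sum_gp_strict[of "3/4::real" m] by simp

text \<open>\<open>s\<close> counts the entries that the recursion has dropped, and the invariant is
  that \<open>v\<close> dominates \<open>W * head_prob\<close> at \<open>s\<close>. Dropping one
  more entry on each side multiplies \<open>head_prob\<close> by the two factors that
  \<open>decay\<close> rounds up.\<close>

lemma nval_miss_bound:
  assumes "length xs = n" "length ys = n" "0 < n" "s \<le> n" "0 \<le> W"
    and "W * head_prob (prob_of xs) (prob_of (rev ys)) s \<le> nval v"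
  shows "W * (\<Sum>k = n - 1 + s..<h. miss_prob (prob_of xs) (prob_of (rev ys)) k)
    \<le> nval (miss_bound v (drop s xs) ys (drop s (rev ys)))"
  using assms(4,6)
proof (induction "n - s" arbitrary: s v)
  case 0
  let ?a = "prob_of xs" and ?b = "prob_of (rev ys)"
  from 0 have [simp]: "s = n" by simp
  have hp: "0 \<le> head_prob ?a ?b n"
    unfolding head_prob_def using prob_of_bounds[of xs] prob_of_bounds[of "rev ys"]
    by (intro prod_nonneg mult_nonneg_nonneg) (auto intro: order_trans[of _ 1])
  have "(\<Sum>k = n - 1 + n..<h. miss_prob ?a ?b k)
      = (\<Sum>r<h - (n - 1 + n). miss_prob ?a ?b (n - 1 + n + r))"
    by (rule sum.reindex_bij_witness[of _ "\<lambda>r. n - 1 + n + r" "\<lambda>k. k - (n - 1 + n)"]) auto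
  also have "\<dots> = head_prob ?a ?b n * (\<Sum>r<h - (n - 1 + n). (3/4) ^ r)"
    unfolding miss_prob_tail[OF assms(1-3)] sum_distrib_left ..
  also have "\<dots> \<le> head_prob ?a ?b n * 4"
    by (intro mult_left_mono sum_geometric_le hp)
  finally have "W * (\<Sum>k = n - 1 + n..<h. miss_prob ?a ?b k) \<le> W * (head_prob ?a ?b n * 4)"
    using assms(5) by (rule mult_left_mono)
  also have "\<dots> \<le> 4 * nval v" using 0 by simp
  finally show ?case using assms by simp
next
  case (Suc d)
  let ?a = "prob_of xs" and ?b = "prob_of (rev ys)"
  from Suc have s: "s < n" by simp
  define x where "x = xs ! s"
  define b where "b = rev ys ! s"
  have dx: "drop s xs = x # drop (Suc s) xs" and db: "drop s (rev ys) = b # drop (Suc s) (rev ys)"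
    using s assms by (simp_all add: Cons_nth_drop_Suc x_def b_def)
  have ab: "?a s = bit_prob x" "?b s = bit_prob b" using s assms by (simp_all add: prob_of_def x_def b_def)
  have fac: "0 \<le> 1 - bit_prob x / 2" "0 \<le> 1 - bit_prob b / 2"
    using bit_prob_bounds(2)[of x] bit_prob_bounds(2)[of b] by simp_all
  have "W * head_prob ?a ?b (Suc s) = W * head_prob ?a ?b s * (1 - bit_prob b / 2) * (1 - bit_prob x / 2)"
    by (simp add: head_prob_def ab mult_ac)
  also have "\<dots> \<le> nval v * (1 - bit_prob b / 2) * (1 - bit_prob x / 2)"
    using Suc.prems fac by (intro mult_right_mono) auto
  also have "\<dots> \<le> nval (decay b v) * (1 - bit_prob x / 2)"
    using fac by (intro mult_right_mono nval_decay)
  also have "\<dots> \<le> nval (decay x (decay b v))" by (rule nval_decay)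
  finally have IH: "W * (\<Sum>k = n - 1 + Suc s..<h. miss_prob ?a ?b k)
      \<le> nval (miss_bound (decay x (decay b v)) (drop (Suc s) xs) ys (drop (Suc s) (rev ys)))"
    using s Suc.hyps by (intro Suc.hyps(1)) auto
  let ?P = "\<Prod>i<n - s. 1 - bit_prob (xs ! (s + i)) * bit_prob (ys ! i)"
  have coin_dist_nonneg: "0 \<le> ?P" by (intro prod_nonneg) (simp add: bit_prob_bounds mult_le_one)
  have mp: "W * miss_prob ?a ?b (n - 1 + s) \<le> nval v * ?P"
    using mult_right_mono[OF Suc.prems(2) coin_dist_nonneg]
    unfolding miss_prob_mid[OF assms(1,2) s] by (simp add: mult.assoc)
  have head: "W * miss_prob ?a ?b (n - 1 + s)
      \<le> (if covered (drop s xs) ys then 0 else nval (list_decay v (drop s xs) ys))"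
  proof (cases "covered (drop s xs) ys")
    case True
    then obtain i where "i < n - s" "xs ! (s + i) = Present" "ys ! i = Present"
      using assms s by (auto simp: covered_iff)
    then have P0: "?P = 0" by (intro prod_zero) (auto intro!: bexI[of _ i])
    show ?thesis using mp True unfolding P0 by simp
  next
    case False
    have "min (length (drop s xs)) (length ys) = n - s" using assms by simp
    then have "nval v * ?P \<le> nval (list_decay v (drop s xs) ys)"
      using nval_list_decay[of v "drop s xs" ys] assms s by simp
    then show ?thesis using mp False by simp
  qed
  have "(\<Sum>k = n - 1 + s..<h. miss_prob ?a ?b k)
      \<le> miss_prob ?a ?b (n - 1 + s) + (\<Sum>k = n - 1 + Suc s..<h. miss_prob ?a ?b k)"
    using miss_prob_nonneg[of ?a ?b "n - 1 + s", OF prob_of_bounds prob_of_bounds]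
    by (cases "n - 1 + s < h") (simp_all add: sum.atLeast_Suc_lessThan)
  from mult_left_mono[OF this assms(5)] IH head show ?case
    unfolding dx db by (auto simp: Let_def distrib_left)
qed

section \<open>Soundness of the decision tree\<close>

lemma query_NoneD:
  "query xs ys = None \<Longrightarrow> length xs = length ys \<Longrightarrow> i < length xs \<Longrightarrow> xs ! i = Absent \<or> ys ! i = Absent"
  by (induction xs ys arbitrary: i rule: query.induct) (simp_all add: nth_Cons split: nat.splits)

lemma query_SomeD:
  "query xs ys = Some (d, i) \<Longrightarrow> \<not> covered xs ys \<Longrightarrow> length xs = length ys \<Longrightarrow>
     i < length xs \<and> (if d then xs ! i = Open else ys ! i = Open)"
proof (induction xs ys arbitrary: i rule: query.induct)
  \<comment> \<open>Two present bits, which contradict that the number is not covered.\<close>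
  case ("4_2" xs ys)
  then show ?case by auto
qed (auto split: if_splits)

text \<open>Revealing a fair bit can only shrink the support, so whatever holds on the support stays
  true.\<close>

lemma weight_update_nonzeroD:
  assumes "weight h (a(i := v)) A \<noteq> 0" "a i = 1/2"
  shows "weight h a A \<noteq> 0"
proof -
  have "(if k \<in> A then a k else 1 - a k) \<noteq> 0" if "k < h" for k
    using assms that unfolding weight_def by (cases "k = i") (auto split: if_splits)
  then show ?thesis unfolding weight_def by simp
qed

text \<open>The count \<open>c\<close> of missing elements below the current number is already certain.\<close>

definition known_missing :: "nat \<Rightarrow> nat \<Rightarrow> bit list \<Rightarrow> bit list \<Rightarrow> bool" where
  "known_missing h c xs ys \<longleftrightarrow>
     (\<forall>A B. A \<subseteq> {..<h} \<longrightarrow> B \<subseteq> {..<h} \<longrightarrow> weight h (prob_of xs) A \<noteq> 0 \<longrightarrow> weight h (prob_of (rev ys)) B \<noteq> 0 \<longrightarrow>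
        card (missing h A B \<inter> {..<length xs - 1}) = c)"

lemma finite_missing [simp]: "finite (missing h A B)"
  unfolding missing_def by simp

text \<open>On the support the count is \<open>c\<close> plus the number of missing elements from
  \<open>length ys - 1\<close> on. The minorant is affine in that number, so only its expectation
  matters, which is a sum of values of \<open>miss_prob\<close>. As the minorant is nonincreasing,
  an upper bound for this sum suffices.\<close>

lemma leaf_sound:
  assumes l: "\<And>c. 0 \<le> snd (l c)"
      "\<And>c y. of_int (fst (l c)) - of_int (snd (l c)) * real y \<le> f (c + y)"
    and len: "length xs = length ys" "0 < length ys" "length ys \<le> h"
    and known: "known_missing h c xs ys"
  shows "of_int (leaf l c w xs ys)
    \<le> nval w * expect h (prob_of xs) (prob_of (rev ys)) (\<lambda>A B. f (card (missing h A B)))"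
proof -
  define n g s where "n = length ys" and "g = fst (l c)" and "s = snd (l c)"
  let ?E = "expect h (prob_of xs) (prob_of (rev ys))"
  let ?U = "\<Sum>k = n - 1..<h. miss_prob (prob_of xs) (prob_of (rev ys)) k"
  have "of_int g - of_int s * ?U
      = ?E (\<lambda>A B. of_int g + (- of_int s) * (\<Sum>k = n - 1..<h. of_bool (k \<in> missing h A B)))"
    unfolding expect_add expect_const expect_cmult expect_sum by (simp add: expect_missing miss_prob_def)
  also have "\<dots> \<le> ?E (\<lambda>A B. f (card (missing h A B)))"
  proof (rule expect_mono[OF prob_of_bounds prob_of_bounds])
    fix A B
    assume AB: "weight h (prob_of xs) A \<noteq> 0" "weight h (prob_of (rev ys)) B \<noteq> 0" "A \<subseteq> {..<h}" "B \<subseteq> {..<h}"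
    have "card (missing h A B)
        = card ((missing h A B \<inter> {..<n - 1}) \<union> (missing h A B \<inter> {n - 1..<h}))"
      by (rule arg_cong[of _ _ card]) (auto simp: missing_def)
    also have "\<dots> = card (missing h A B \<inter> {..<n - 1}) + card (missing h A B \<inter> {n - 1..<h})"
      by (rule card_Un_disjoint) auto
    also have "card (missing h A B \<inter> {..<n - 1}) = c"
      using known AB len unfolding known_missing_def n_def by auto
    finally have card: "card (missing h A B) = c + card (missing h A B \<inter> {n - 1..<h})" .
    have "(\<Sum>k = n - 1..<h. of_bool (k \<in> missing h A B)) = real (card (missing h A B \<inter> {n - 1..<h}))"
      by (simp add: Int_commute[of "{n - 1..<h}"] del: One_nat_def)
    then show "of_int g + (- of_int s) * (\<Sum>k = n - 1..<h. of_bool (k \<in> missing h A B))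
        \<le> f (card (missing h A B))"
      using l(2)[of c "card (missing h A B \<inter> {n - 1..<h})"] by (simp add: card g_def s_def)
  qed
  finally have E: "of_int g - of_int s * ?U \<le> ?E (\<lambda>A B. f (card (missing h A B)))" .
  have nv: "of_int (numeral v) = nval v" for v by (simp add: nval_def)
  have "nval w * ?U \<le> nval (miss_bound w xs ys (rev ys))"
    using nval_miss_bound[OF len(1) refl len(2), of 0 "nval w" w h] by (simp add: head_prob_def n_def)
  then have "of_int s * (nval w * ?U) \<le> of_int s * nval (miss_bound w xs ys (rev ys))"
    using l(1) by (intro mult_left_mono) (auto simp: s_def)
  then have "of_int (leaf l c w xs ys) \<le> nval w * (of_int g - of_int s * ?U)"
    unfolding leaf_def g_def s_def
    by (auto simp: nv algebra_simps case_prod_beta simp del: of_int_numeral)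
  also have "\<dots> \<le> nval w * ?E (\<lambda>A B. f (card (missing h A B)))"
    using E by (intro mult_left_mono) auto
  finally show ?thesis .
qed

text \<open>An appended open bit leaves \<open>prob_of\<close> unchanged. The number
  \<open>n - 1\<close> joins the counted range, and \<open>d\<close> is its fate on the whole
  support.\<close>

lemma known_missing_advance:
  assumes len: "length xs = n" "length ys = n" "0 < n" "n \<le> h"
    and known: "known_missing h c xs ys"
    and new: "\<And>A B. weight h (prob_of xs) A \<noteq> 0 \<Longrightarrow> weight h (prob_of (rev ys)) B \<noteq> 0 \<Longrightarrow> n - 1 \<in> missing h A B \<longleftrightarrow> d"
  shows "known_missing h (c + of_bool d) (xs @ [Open]) (Open # ys)"
  unfolding known_missing_def
proof (intro allI impI)
  fix A B
  assume "A \<subseteq> {..<h}" "B \<subseteq> {..<h}" "weight h (prob_of (xs @ [Open])) A \<noteq> 0" "weight h (prob_of (rev (Open # ys))) B \<noteq> 0"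
  then have AB: "A \<subseteq> {..<h}" "B \<subseteq> {..<h}" "weight h (prob_of xs) A \<noteq> 0" "weight h (prob_of (rev ys)) B \<noteq> 0"
    by (simp_all add: prob_of_snoc)
  have c: "card (missing h A B \<inter> {..<n - 1}) = c"
    using known AB len unfolding known_missing_def by auto
  have "{..<n} = insert (n - 1) {..<n - 1}" using len(3) by auto
  then have "missing h A B \<inter> {..<n}
      = (if d then insert (n - 1) (missing h A B \<inter> {..<n - 1}) else missing h A B \<inter> {..<n - 1})"
    using new[OF AB(3,4)] by auto
  then show "card (missing h A B \<inter> {..<length (xs @ [Open]) - 1}) = c + of_bool d"
    using c len by auto
qed

lemma known_missing_covered:
  assumes len: "length xs = n" "length ys = n" "0 < n" "n \<le> h"
    and known: "known_missing h c xs ys" and "covered xs ys"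
  shows "known_missing h c (xs @ [Open]) (Open # ys)"
proof -
  obtain i where i: "i < n" "xs ! i = Present" "ys ! i = Present"
    using assms by (auto simp: covered_iff)
  have "n - 1 \<notin> missing h A B" if "weight h (prob_of xs) A \<noteq> 0" "weight h (prob_of (rev ys)) B \<noteq> 0" for A B
  proof -
    have "i \<in> A" by (rule weight_nonzeroD(2)[OF that(1)]) (use i len in \<open>auto simp: prob_of_def\<close>)
    moreover have "n - 1 - i \<in> B"
      by (rule weight_nonzeroD(2)[OF that(2)]) (use i len in \<open>auto simp: prob_of_def rev_nth\<close>)
    ultimately show ?thesis using i by (auto simp: missing_def intro!: exI[of _ i])
  qed
  then show ?thesis
    using known_missing_advance[OF len known, of False] by simp
qed

lemma known_missing_uncovered:
  assumes len: "length xs = n" "length ys = n" "0 < n" "n \<le> h"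
    and known: "known_missing h c xs ys" and "query xs ys = None"
  shows "known_missing h (Suc c) (xs @ [Open]) (Open # ys)"
proof -
  have "n - 1 \<in> missing h A B" if "weight h (prob_of xs) A \<noteq> 0" "weight h (prob_of (rev ys)) B \<noteq> 0" for A B
  proof -
    have "\<not> (i \<in> A \<and> n - 1 - i \<in> B)" if "i \<le> n - 1" for i
    proof -
      have i: "i < n" using that len by auto
      from query_NoneD[OF assms(6)] i len consider "xs ! i = Absent" | "ys ! i = Absent" by auto
      then show ?thesis
      proof cases
        case 1
        have "i \<notin> A"
          by (rule weight_nonzeroD(1)[OF \<open>weight h (prob_of xs) A \<noteq> 0\<close>]) (use 1 i len in \<open>auto simp: prob_of_def\<close>)
        then show ?thesis by simp
      next
        case 2
        have "n - 1 - i \<notin> B"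
          by (rule weight_nonzeroD(1)[OF \<open>weight h (prob_of (rev ys)) B \<noteq> 0\<close>])
             (use 2 i len in \<open>auto simp: prob_of_def rev_nth\<close>)
        then show ?thesis by simp
      qed
    qed
    then show ?thesis using len by (auto simp: missing_def)
  qed
  then show ?thesis
    using known_missing_advance[OF len known, of True] by simp
qed

lemma prob_of_rev_update:
  "i < length ys \<Longrightarrow> prob_of (rev (ys[i := v])) = (prob_of (rev ys))(length ys - 1 - i := bit_prob v)"
  by (simp add: rev_update prob_of_update)

lemma known_missing_left:
  assumes "known_missing h c xs ys" "i < length xs" "xs ! i = Open"
  shows "known_missing h c (xs[i := v]) ys"
  using assms weight_update_nonzeroD[of h "prob_of xs" i "bit_prob v"]
  unfolding known_missing_def by (simp add: prob_of_update prob_of_def[of xs i])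

lemma known_missing_right:
  assumes "known_missing h c xs ys" "i < length ys" "ys ! i = Open"
  shows "known_missing h c xs (ys[i := v])"
  using assms weight_update_nonzeroD[of h "prob_of (rev ys)" "length ys - 1 - i" "bit_prob v"]
  unfolding known_missing_def by (simp add: prob_of_rev_update prob_of_def[of "rev ys"] rev_nth)

text \<open>Induction along the recursion. Splitting on a bit halves the scale, which accounts for
  the factor \<open>1/2\<close> of \<open>expect_split_left\<close> and
  \<open>expect_split_right\<close>. The lists grow only by spending budget, so
  \<open>length ys + t \<le> h\<close> keeps them within the horizon.\<close>

lemma lower_bound_sound:
  assumes l: "\<And>c. 0 \<le> snd (l c)"
      "\<And>c y. of_int (fst (l c)) - of_int (snd (l c)) * real y \<le> f (c + y)"
    and "length xs = length ys" "0 < length ys" "length ys + t \<le> h" "known_missing h c xs ys"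
  shows "of_int (lower_bound l t c w xs ys)
    \<le> nval w * expect h (prob_of xs) (prob_of (rev ys)) (\<lambda>A B. f (card (missing h A B)))"
  using assms
proof (induction l t c w xs ys rule: lower_bound.induct)
  case (1 l t c w xs ys)
  let ?V = "\<lambda>xs ys. expect h (prob_of xs) (prob_of (rev ys)) (\<lambda>A B. f (card (missing h A B)))"
  note len = 1(9,10) and bud = 1(11) and known = 1(12)
  show ?case
  proof (cases "2 < c")
    case True
    have "of_int (leaf l c (num.Bit0 w) xs ys) \<le> nval (num.Bit0 w) * ?V xs ys"
      by (rule leaf_sound) (use 1(7,8) len bud known in auto)
    then show ?thesis using True by simp
  next
    case c: False
    show ?thesis
    proof (cases "covered xs ys")
      case True
      then have "known_missing h c (xs @ [Open]) (Open # ys)"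
        using len bud known by (intro known_missing_covered[where n = "length ys"]) auto
      then have "of_int (lower_bound l t c (num.Bit0 w) (xs @ [Open]) (Open # ys))
          \<le> nval (num.Bit0 w) * ?V (xs @ [Open]) (Open # ys)"
        using len bud by (intro 1(1)[OF c True 1(7,8)]) auto
      then show ?thesis using c True by (simp add: prob_of_snoc)
    next
      case nc: False
      show ?thesis
      proof (cases "query xs ys")
        case None
        then have "known_missing h (Suc c) (xs @ [Open]) (Open # ys)"
          using len bud known by (intro known_missing_uncovered[where n = "length ys"]) auto
        then have "of_int (lower_bound l t (Suc c) (num.Bit0 w) (xs @ [Open]) (Open # ys))
            \<le> nval (num.Bit0 w) * ?V (xs @ [Open]) (Open # ys)"
          using len bud by (intro 1(2)[OF c nc None 1(7,8)]) auto
        then show ?thesis using c nc None by (simp add: prob_of_snoc)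
      next
        case (Some p)
        obtain d i where p: "p = (d, i)" by force
        from query_SomeD[of xs ys d i] Some p nc len
        have i: "i < length ys" "if d then xs ! i = Open else ys ! i = Open" by auto
        show ?thesis
        proof (cases d)
          case True
          then have open_i: "xs ! i = Open" using i by simp
          have "of_int (lower_bound l (Suc (Suc t)) c w (xs[i := Absent]) ys) \<le> nval w * ?V (xs[i := Absent]) ys"
            using len bud known_missing_left[OF known _ open_i] i
            by (intro 1(3)[OF c nc Some p[symmetric] eqTrueI[OF True] 1(7,8)]) auto
          moreover have "of_int (lower_bound l t c w (xs[i := Present]) ys) \<le> nval w * ?V (xs[i := Present]) ys"
            using len bud known_missing_left[OF known _ open_i] i
            by (intro 1(4)[OF c nc Some p[symmetric] eqTrueI[OF True] 1(7,8)]) auto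
          moreover have "?V xs ys = (?V (xs[i := Absent]) ys + ?V (xs[i := Present]) ys) / 2"
            using expect_split_left[of "prob_of xs" i h] open_i i len bud by (simp add: prob_of_update prob_of_def[of xs i])
          ultimately show ?thesis using c nc Some p True by (simp add: algebra_simps)
        next
          case False
          then have open_i: "ys ! i = Open" using i by simp
          have "of_int (lower_bound l (Suc (Suc t)) c w xs (ys[i := Absent])) \<le> nval w * ?V xs (ys[i := Absent])"
            using len bud known_missing_right[OF known _ open_i] i
            by (intro 1(5)[OF c nc Some p[symmetric] eq_False[THEN iffD2, OF False] 1(7,8)]) auto
          moreover have "of_int (lower_bound l t c w xs (ys[i := Present])) \<le> nval w * ?V xs (ys[i := Present])"
            using len bud known_missing_right[OF known _ open_i] i
            by (intro 1(6)[OF c nc Some p[symmetric] eq_False[THEN iffD2, OF False] 1(7,8)]) auto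
          moreover have "?V xs ys = (?V xs (ys[i := Absent]) + ?V xs (ys[i := Present])) / 2"
            using expect_split_right[of "prob_of (rev ys)" "length ys - 1 - i" h] open_i i len bud
            by (simp add: prob_of_rev_update prob_of_def[of "rev ys" "length ys - Suc i"] rev_nth)
          ultimately show ?thesis using c nc Some p False by (simp add: algebra_simps)
        qed
      qed
    qed
  qed
\<comment> \<open>In the remaining clauses the budget is too small or the scale is not even, and the
  value is that of \<open>leaf\<close>.\<close>
qed (simp_all only: lower_bound.simps, (rule leaf_sound; linarith?; assumption?)+)

section \<open>Numerical certificates\<close>

fun pow2 :: "nat \<Rightarrow> num" where
  "pow2 0 = num.One"
| "pow2 (Suc n) = num.Bit0 (pow2 n)"

text \<open>Minorants of the function with value \<open>-1\<close> at \<open>0\<close>,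
  \<open>4\<close> at \<open>2\<close> and \<open>0\<close> elsewhere, for the inequality
  \<open>q 0 < 4 q 2\<close>. At \<open>c = 0\<close> the global lower bound \<open>-1\<close> is
  taken.\<close>

definition tangents_2_0 :: "nat \<Rightarrow> int \<times> int" where
  "tangents_2_0 c = (if c = 0 then (-1, 0) else if c = 2 then (4, 4) else (0, 0))"

text \<open>Minorants of the function with values \<open>5\<close>, \<open>5\<close>,
  \<open>4\<close> at \<open>0\<close>, \<open>1\<close>, \<open>2\<close> and \<open>0\<close>
  beyond. For \<open>c \<le> 2\<close> the slope is the least integer that brings the line to at
  most \<open>0\<close> at the total \<open>3\<close>.\<close>

definition tangents_012 :: "nat \<Rightarrow> int \<times> int" where
  "tangents_012 c = (if c = 0 then (5, 2) else if c = 1 then (5, 3) else if c = 2 then (4, 4) else (0, 0))"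

text \<open>\<open>2 ^ 42\<close> is the number \<open>4\<close> at scale \<open>2 ^ 40\<close>. The
  singleton lists say that \<open>0\<close> lies in \<open>A\<close> and in
  \<open>B\<close>.\<close>

lemma lower_bound_012: "2 ^ 42 < lower_bound tangents_012 39 0 (pow2 40) [Present] [Present]"
  by code_simp

lemma lower_bound_2_0: "0 < lower_bound tangents_2_0 64 0 (pow2 40) [Present] [Present]"
  by code_simp

subsection \<open>The limit distribution\<close>

definition missing_dist :: "nat \<Rightarrow> (nat \<Rightarrow> real) \<Rightarrow> (nat \<Rightarrow> real) \<Rightarrow> nat \<Rightarrow> real" where
  "missing_dist h a b k = expect h a b (\<lambda>A B. of_bool (card (missing h A B) = k))"

lemma weight_Suc: "weight (Suc h) a A = weight h a A * (if h \<in> A then a h else 1 - a h)"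
  by (simp add: weight_def)

lemma weight_insert: "weight h a (insert h A) = weight h a A"
  unfolding weight_def by (intro prod.cong) auto

lemma sum_weight_restrict:
  "(\<Sum>A\<in>Pow {..<Suc h}. weight (Suc h) a A * G (A \<inter> {..<h})) = (\<Sum>A\<in>Pow {..<h}. weight h a A * G A)"
  unfolding sum_Pow_lessThan_Suc
proof (intro sum.cong refl)
  fix A assume A: "A \<in> Pow {..<h}"
  then have "A \<inter> {..<h} = A" "insert h A \<inter> {..<h} = A" "h \<notin> A" by auto
  then show "weight (Suc h) a A * G (A \<inter> {..<h}) + weight (Suc h) a (insert h A) * G (insert h A \<inter> {..<h})
      = weight h a A * G A"
    by (simp add: weight_Suc weight_insert algebra_simps)
qed

text \<open>The two weights of bit \<open>h\<close> add up to \<open>1\<close>, so a bit that is not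
  looked at can be summed out.\<close>

lemma expect_restrict: "expect (Suc h) a b (\<lambda>A B. F (A \<inter> {..<h}) (B \<inter> {..<h})) = expect h a b F"
proof -
  have "expect (Suc h) a b (\<lambda>A B. F (A \<inter> {..<h}) (B \<inter> {..<h}))
      = (\<Sum>A\<in>Pow {..<Suc h}. weight (Suc h) a A *
          (\<Sum>B\<in>Pow {..<Suc h}. weight (Suc h) b B * F (A \<inter> {..<h}) (B \<inter> {..<h})))"
    by (simp add: expect_def sum_distrib_left mult.assoc)
  also have "\<dots> = (\<Sum>A\<in>Pow {..<Suc h}. weight (Suc h) a A *
      (\<Sum>B\<in>Pow {..<h}. weight h b B * F (A \<inter> {..<h}) B))"
    by (simp only: sum_weight_restrict)
  also have "\<dots> = (\<Sum>A\<in>Pow {..<h}. weight h a A * (\<Sum>B\<in>Pow {..<h}. weight h b B * F A B))"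
    by (rule sum_weight_restrict)
  also have "\<dots> = expect h a b F" by (simp add: expect_def sum_distrib_left mult.assoc)
  finally show ?thesis .
qed

lemma card_missing_Suc:
  "card (missing (Suc h) A B)
     = card (missing h (A \<inter> {..<h}) (B \<inter> {..<h})) + of_bool (h \<in> missing (Suc h) A B)"
proof -
  have "missing (Suc h) A B = (if h \<in> missing (Suc h) A B
      then insert h (missing h (A \<inter> {..<h}) (B \<inter> {..<h})) else missing h (A \<inter> {..<h}) (B \<inter> {..<h}))"
    by (auto simp: missing_def less_Suc_eq)
  moreover have "h \<notin> missing h (A \<inter> {..<h}) (B \<inter> {..<h})" by (simp add: missing_def)
  ultimately show ?thesis
    by (smt (verit) card_insert_disjoint finite_missing of_bool_eq add.right_neutral Suc_eq_plus1)
qed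

lemma expect_diff_le:
  assumes "\<And>i. a i \<in> {0..1}" "\<And>i. b i \<in> {0..1}" "\<And>A B. \<bar>F A B - G A B\<bar> \<le> R A B"
  shows "\<bar>expect h a b F - expect h a b G\<bar> \<le> expect h a b R"
proof -
  have "expect h a b F \<le> expect h a b (\<lambda>A B. G A B + R A B)"
    using assms(3) by (intro expect_mono assms) (smt (verit))
  moreover have "expect h a b G \<le> expect h a b (\<lambda>A B. F A B + R A B)"
    using assms(3) by (intro expect_mono assms) (smt (verit))
  ultimately show ?thesis by (simp add: expect_add)
qed

text \<open>The two counts differ only if \<open>h\<close> is missing, and each of the
  \<open>h + 1\<close> pairs fails to be present with probability at most
  \<open>3/4\<close>.\<close>

lemma missing_dist_step:
  assumes "\<And>i. a i \<in> {1/2..1}" "\<And>i. b i \<in> {1/2..1}"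
  shows "\<bar>missing_dist (Suc h) a b k - missing_dist h a b k\<bar> \<le> (3/4) ^ Suc h"
proof -
  have ab: "a i \<in> {0..1}" "b i \<in> {0..1}" for i
    using assms(1)[of i] assms(2)[of i] by auto
  have "missing_dist h a b k = expect (Suc h) a b
      (\<lambda>A B. of_bool (card (missing h (A \<inter> {..<h}) (B \<inter> {..<h})) = k))"
    unfolding missing_dist_def by (rule expect_restrict[symmetric])
  then have "\<bar>missing_dist (Suc h) a b k - missing_dist h a b k\<bar>
      \<le> expect (Suc h) a b (\<lambda>A B. of_bool (h \<in> missing (Suc h) A B))"
    using expect_diff_le[OF ab, where h = "Suc h" and R = "\<lambda>A B. of_bool (h \<in> missing (Suc h) A B)"]
    by (simp add: missing_dist_def card_missing_Suc)
  also have "\<dots> = (\<Prod>i\<le>h. 1 - a i * b (h - i))" by (rule expect_missing) simp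
  also have "\<dots> \<le> (\<Prod>i\<le>h. 3/4)"
  proof (intro prod_mono conjI)
    fix i
    have "1/2 * (1/2) \<le> a i * b (h - i)"
      using assms(1)[of i] assms(2)[of "h - i"] by (intro mult_mono) auto
    then show "1 - a i * b (h - i) \<le> 3/4" by simp
    show "0 \<le> 1 - a i * b (h - i)" using ab by (simp add: mult_le_one)
  qed
  finally show ?thesis by simp
qed

lemma geometric_Cauchy_limit:
  fixes x :: "nat \<Rightarrow> real"
  assumes "\<And>h. \<bar>x (Suc h) - x h\<bar> \<le> (3/4) ^ Suc h"
  obtains L where "x \<longlonglongrightarrow> L" "\<And>h. \<bar>x h - L\<bar> \<le> 4 * (3/4) ^ Suc h"
proof -
  have "summable (\<lambda>h. (3/4::real) ^ Suc h)" by simp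
  then have "summable (\<lambda>h. x (Suc h) - x h)"
    by (rule summable_comparison_test[rotated]) (use assms in auto)
  then have "(\<lambda>n. \<Sum>h<n. x (Suc h) - x h) \<longlonglongrightarrow> (\<Sum>h. x (Suc h) - x h)"
    by (rule summable_LIMSEQ)
  then have "(\<lambda>n. x n - x 0) \<longlonglongrightarrow> (\<Sum>h. x (Suc h) - x h)"
    by (simp add: sum_lessThan_telescope)
  then have lim: "x \<longlonglongrightarrow> (\<Sum>h. x (Suc h) - x h) + x 0"
    using tendsto_add[OF _ tendsto_const[of "x 0"]] by fastforce
  \<comment> \<open>The right-hand side is the exact partial sum of the geometric series; keeping
    the subtracted term lets the induction on \<open>d\<close> close.\<close>
  have dist: "\<bar>x h - x (h + d)\<bar> \<le> 4 * (3/4) ^ Suc h - 4 * (3/4) ^ Suc (h + d)" for h d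
  proof (induction d)
    case (Suc d)
    have "\<bar>x h - x (h + Suc d)\<bar> \<le> \<bar>x h - x (h + d)\<bar> + \<bar>x (Suc (h + d)) - x (h + d)\<bar>"
      by simp
    then show ?case using Suc assms[of "h + d"] by simp
  qed simp
  have "\<bar>x h - ((\<Sum>h. x (Suc h) - x h) + x 0)\<bar> \<le> 4 * (3/4) ^ Suc h" for h
  proof (rule LIMSEQ_le_const2)
    show "(\<lambda>d. \<bar>x h - x (d + h)\<bar>) \<longlonglongrightarrow> \<bar>x h - ((\<Sum>h. x (Suc h) - x h) + x 0)\<bar>"
      by (intro tendsto_intros LIMSEQ_ignore_initial_segment lim)
    have "\<bar>x h - x (d + h)\<bar> \<le> 4 * (3/4) ^ Suc h" for d
    proof -
      have "0 \<le> (3/4::real) ^ Suc (h + d)" by simp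
      then show ?thesis using dist[of h d] unfolding add.commute[of d h] by linarith
    qed
    then show "\<exists>N. \<forall>d\<ge>N. \<bar>x h - x (d + h)\<bar> \<le> 4 * (3/4) ^ Suc h" by blast
  qed
  with lim show thesis by (rule that)
qed

section \<open>Shifts and the recursion for the distribution\<close>

lemma sum_weight_shift:
  assumes "a 0 = 0"
  shows "(\<Sum>A\<in>Pow {..<Suc h}. weight (Suc h) a A * G A) = (\<Sum>A\<in>Pow {..<h}. weight h (a \<circ> Suc) A * G (Suc ` A))"
proof -
  have img: "(`) Suc ` Pow {..<h} = {A \<in> Pow {..<Suc h}. 0 \<notin> A}"
  proof -
    have "Suc ` {..<h} = {..<Suc h} - {0}"
      by (auto simp: image_iff less_Suc_eq_0_disj)
    then have "(`) Suc ` Pow {..<h} = Pow ({..<Suc h} - {0})"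
      by (simp only: image_Pow_surj)
    then show ?thesis by auto
  qed
  have weight: "weight (Suc h) a (Suc ` A) = weight h (a \<circ> Suc) A" for A
    unfolding weight_def prod.lessThan_Suc_shift using assms
    by (auto intro!: prod.cong simp: image_iff)
  have "(\<Sum>A\<in>Pow {..<Suc h}. weight (Suc h) a A * G A) = (\<Sum>A\<in>(`) Suc ` Pow {..<h}. weight (Suc h) a A * G A)"
    unfolding img
  proof (rule sum.mono_neutral_right)
    show "\<forall>A\<in>Pow {..<Suc h} - {A \<in> Pow {..<Suc h}. 0 \<notin> A}. weight (Suc h) a A * G A = 0"
      using weight_nonzeroD(1)[of "Suc h" a _ 0] assms by auto
  qed auto
  also have "\<dots> = (\<Sum>A\<in>Pow {..<h}. weight (Suc h) a (Suc ` A) * G (Suc ` A))"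
    by (subst sum.reindex) (auto intro!: inj_onI simp: inj_image_eq_iff)
  finally show ?thesis by (simp add: weight)
qed

text \<open>\<open>(A + 1) + B = (A + B) + 1\<close>. The bit \<open>h\<close> of \<open>B\<close>
  could only produce numbers beyond the horizon.\<close>

lemma missing_shift:
  "missing (Suc h) (Suc ` A) B = insert 0 (Suc ` missing h A (B \<inter> {..<h}))"
proof (rule set_eqI)
  fix j
  show "j \<in> missing (Suc h) (Suc ` A) B \<longleftrightarrow> j \<in> insert 0 (Suc ` missing h A (B \<inter> {..<h}))"
  proof (cases j)
    case (Suc j')
    have "(\<forall>i\<le>Suc j'. \<not> (i \<in> Suc ` A \<and> Suc j' - i \<in> B)) \<longleftrightarrow> (\<forall>i\<le>j'. \<not> (i \<in> A \<and> j' - i \<in> B))"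
    proof -
      have "(\<forall>i\<le>Suc j'. R i) \<longleftrightarrow> R 0 \<and> (\<forall>i\<le>j'. R (Suc i))" for R
        by (metis Suc_le_mono le0 not0_implies_Suc)
      from this[of "\<lambda>i. \<not> (i \<in> Suc ` A \<and> Suc j' - i \<in> B)"] show ?thesis
        by (auto simp: image_iff)
    qed
    then show ?thesis unfolding Suc missing_def by (auto simp: image_iff)
  qed (auto simp: missing_def)
qed

lemma missing_dist_shift:
  assumes "a 0 = 0"
  shows "missing_dist (Suc h) a b (Suc k) = missing_dist h (a \<circ> Suc) b k" "missing_dist (Suc h) a b 0 = 0"
proof -
  have card: "card (missing (Suc h) (Suc ` A) B) = Suc (card (missing h A (B \<inter> {..<h})))" for A B
    unfolding missing_shift by (subst card_insert_disjoint) (auto simp: card_image)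
  have *: "missing_dist (Suc h) a b m = (\<Sum>A\<in>Pow {..<h}. weight h (a \<circ> Suc) A *
      (\<Sum>B\<in>Pow {..<h}. weight h b B * of_bool (Suc (card (missing h A B)) = m)))" for m
  proof -
    have "missing_dist (Suc h) a b m = (\<Sum>A\<in>Pow {..<Suc h}. weight (Suc h) a A *
        (\<Sum>B\<in>Pow {..<Suc h}. weight (Suc h) b B * of_bool (card (missing (Suc h) A B) = m)))"
      by (simp only: missing_dist_def expect_def sum_distrib_left mult.assoc)
    also have "\<dots> = (\<Sum>A\<in>Pow {..<h}. weight h (a \<circ> Suc) A *
        (\<Sum>B\<in>Pow {..<Suc h}. weight (Suc h) b B * of_bool (card (missing (Suc h) (Suc ` A) B) = m)))"
      by (rule sum_weight_shift[of a, OF assms])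
    also have "\<dots> = (\<Sum>A\<in>Pow {..<h}. weight h (a \<circ> Suc) A *
        (\<Sum>B\<in>Pow {..<h}. weight h b B * of_bool (Suc (card (missing h A B)) = m)))"
    proof (rule sum.cong[OF refl])
      fix A
      show "weight h (a \<circ> Suc) A *
          (\<Sum>B\<in>Pow {..<Suc h}. weight (Suc h) b B * of_bool (card (missing (Suc h) (Suc ` A) B) = m))
        = weight h (a \<circ> Suc) A *
          (\<Sum>B\<in>Pow {..<h}. weight h b B * of_bool (Suc (card (missing h A B)) = m))"
        using sum_weight_restrict[of h b "\<lambda>B. of_bool (Suc (card (missing h A B)) = m)"]
        by (simp only: card)
    qed
    finally show ?thesis .
  qed
  show "missing_dist (Suc h) a b (Suc k) = missing_dist h (a \<circ> Suc) b k"
    unfolding * by (simp only: missing_dist_def expect_def sum_distrib_left mult.assoc nat.inject)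
  show "missing_dist (Suc h) a b 0 = 0" unfolding * by simp
qed

lemma missing_dist_commute: "missing_dist h a b k = missing_dist h b a k"
  unfolding missing_dist_def by (subst expect_swap) (simp add: missing_commute)

abbreviation coin :: "nat \<Rightarrow> real" where
  "coin \<equiv> \<lambda>_. 1/2"

text \<open>Approximation at horizon \<open>h\<close> of the limit \<open>p\<close>;
  \<open>anchored_dist\<close> is that of \<open>q\<close>.\<close>

definition coin_dist :: "nat \<Rightarrow> nat \<Rightarrow> real" where
  "coin_dist h k = missing_dist h coin coin k"

definition anchored_dist :: "nat \<Rightarrow> nat \<Rightarrow> real" where
  "anchored_dist h k = missing_dist h (coin(0 := 1)) (coin(0 := 1)) k"

text \<open>Inclusion-exclusion over the events \<open>0 \<notin> A\<close> and
  \<open>0 \<notin> B\<close>, each of probability \<open>1/2\<close>. By symmetry their two terms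
  are equal and add up to one term with coefficient \<open>1\<close>.\<close>

lemma coin_dist_rec:
  "coin_dist (Suc h) k = anchored_dist (Suc h) k / 4 + missing_dist (Suc h) (coin(0 := 0)) coin k
     - missing_dist (Suc h) (coin(0 := 0)) (coin(0 := 0)) k / 4"
proof -
  let ?z = "coin(0 := 0)" and ?o = "coin(0 := 1)"
  let ?D = "\<lambda>a b. missing_dist (Suc h) a b k"
  have left: "?D coin b = (?D ?z b + ?D ?o b) / 2" for b
    unfolding missing_dist_def by (rule expect_split_left) auto
  have right: "?D a coin = (?D a ?z + ?D a ?o) / 2" for a
    unfolding missing_dist_def by (rule expect_split_right) auto
  show ?thesis
    using left[of coin] left[of ?z] right[of ?o] missing_dist_commute[of "Suc h" coin ?z k]
    unfolding coin_dist_def anchored_dist_def by argo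
qed

lemma coin_shift: "coin(0 := v) \<circ> Suc = coin"
  by auto

lemma missing_dist_zero_coin: "missing_dist (Suc h) (coin(0 := 0)) coin (Suc k) = coin_dist h k"
  by (simp add: missing_dist_shift coin_shift coin_dist_def)

lemma missing_dist_zero_zero: "missing_dist (Suc (Suc h)) (coin(0 := 0)) (coin(0 := 0)) (Suc (Suc k)) = coin_dist h k"
  "missing_dist (Suc (Suc h)) (coin(0 := 0)) (coin(0 := 0)) (Suc 0) = 0"
  using missing_dist_commute[of "Suc h" coin "coin(0 := 0)"]
  by (simp_all add: missing_dist_shift coin_shift coin_dist_def)

text \<open>Every shift uses up one position, hence the different horizons, which no longer matter
  in the limit.\<close>

lemma coin_dist_rec_cases:
  "coin_dist (Suc (Suc h)) 0 = anchored_dist (Suc (Suc h)) 0 / 4"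
  "coin_dist (Suc (Suc h)) (Suc 0) = anchored_dist (Suc (Suc h)) (Suc 0) / 4 + coin_dist (Suc h) 0"
  "coin_dist (Suc (Suc h)) (Suc (Suc k)) = anchored_dist (Suc (Suc h)) (Suc (Suc k)) / 4 + coin_dist (Suc h) (Suc k) - coin_dist h k / 4"
  by (simp_all add: coin_dist_rec[of "Suc h"] missing_dist_zero_coin missing_dist_zero_zero missing_dist_shift(2))

lemma expect_nonneg:
  assumes "\<And>i. a i \<in> {0..1}" "\<And>i. b i \<in> {0..1}" "\<And>A B. 0 \<le> F A B"
  shows "0 \<le> expect h a b F"
  using expect_mono[of a b h "\<lambda>_ _. 0" F] assms by (simp add: expect_const)

lemma coin_dist_nonneg: "0 \<le> coin_dist h k"
  unfolding coin_dist_def missing_dist_def by (rule expect_nonneg) auto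

lemma anchored_dist_sum_le: "(\<Sum>k\<in>K. anchored_dist h k) \<le> 1" if "finite K"
proof -
  have "(\<Sum>k\<in>K. anchored_dist h k) = expect h (coin(0 := 1)) (coin(0 := 1))
      (\<lambda>A B. \<Sum>k\<in>K. of_bool (card (missing h A B) = k))"
    by (simp only: anchored_dist_def missing_dist_def expect_sum)
  also have "\<dots> \<le> expect h (coin(0 := 1)) (coin(0 := 1)) (\<lambda>_ _. 1)"
  proof (rule expect_mono)
    fix A B
    have "(\<Sum>k\<in>K. of_bool (card (missing h A B) = k)) = (of_bool (card (missing h A B) \<in> K) :: real)"
      using that by (simp add: of_bool_def)
    then show "(\<Sum>k\<in>K. of_bool (card (missing h A B) = k)) \<le> (1 :: real)" by simp
  qed auto
  finally show ?thesis by (simp add: expect_const)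
qed

lemma anchored_dist_limit:
  obtains q where "(\<lambda>h. anchored_dist h k) \<longlonglongrightarrow> q"
proof -
  have "\<bar>anchored_dist (Suc h) k - anchored_dist h k\<bar> \<le> (3/4) ^ Suc h" for h
    unfolding anchored_dist_def by (rule missing_dist_step) auto
  then show thesis using that geometric_Cauchy_limit[of "\<lambda>h. anchored_dist h k"] by blast
qed

lemma coin_dist_limit:
  obtains p where "(\<lambda>h. coin_dist h k) \<longlonglongrightarrow> p" "\<And>h. \<bar>coin_dist h k - p\<bar> \<le> 4 * (3/4) ^ Suc h"
proof -
  have "\<bar>coin_dist (Suc h) k - coin_dist h k\<bar> \<le> (3/4) ^ Suc h" for h
    unfolding coin_dist_def by (rule missing_dist_step) auto
  then show thesis using that geometric_Cauchy_limit[of "\<lambda>h. coin_dist h k"] by blast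
qed

section \<open>The mode of the limit distribution\<close>

lemma coin_dist_mode:
  assumes "0 < \<delta>" and Q20: "\<And>h. h \<ge> m \<Longrightarrow> \<delta> \<le> 4 * anchored_dist h 2 - anchored_dist h 0"
    and Q012: "\<And>h. h \<ge> m \<Longrightarrow> 4 + \<delta> \<le> 5 * (anchored_dist h 0 + anchored_dist h 1) + 4 * anchored_dist h 2"
  obtains \<epsilon> h0 where "0 < \<epsilon>" "\<And>h k. h \<ge> h0 \<Longrightarrow> k \<noteq> 2 \<Longrightarrow> coin_dist h k + \<epsilon> \<le> coin_dist h 2"
proof -
  have "\<exists>p. (\<lambda>h. coin_dist h k) \<longlonglongrightarrow> p \<and> (\<forall>h. \<bar>coin_dist h k - p\<bar> \<le> 4 * (3/4) ^ Suc h)" for k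
    by (rule coin_dist_limit[of k]) blast
  then obtain p where p: "\<And>k. (\<lambda>h. coin_dist h k) \<longlonglongrightarrow> p k"
    and dist: "\<And>k h. \<bar>coin_dist h k - p k\<bar> \<le> 4 * (3/4) ^ Suc h" by metis
  have "\<exists>q. (\<lambda>h. anchored_dist h k) \<longlonglongrightarrow> q" for k
    by (rule anchored_dist_limit[of k]) blast
  then obtain q where q: "\<And>k. (\<lambda>h. anchored_dist h k) \<longlonglongrightarrow> q k" by metis
  have pS: "(\<lambda>h. coin_dist (Suc h) k) \<longlonglongrightarrow> p k" and pSS: "(\<lambda>h. coin_dist (Suc (Suc h)) k) \<longlonglongrightarrow> p k" for k
    using LIMSEQ_Suc[OF p[of k]] LIMSEQ_Suc[OF LIMSEQ_Suc[OF p[of k]]] by blast+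
  have qSS: "(\<lambda>h. anchored_dist (Suc (Suc h)) k / 4) \<longlonglongrightarrow> q k / 4" for k
    using tendsto_divide[OF LIMSEQ_Suc[OF LIMSEQ_Suc[OF q[of k]]] tendsto_const[of 4]] by simp
  have p0: "p 0 = q 0 / 4"
    using LIMSEQ_unique[OF pSS[of 0, unfolded coin_dist_rec_cases] qSS] .
  have p1: "p (Suc 0) = q (Suc 0) / 4 + p 0"
    using LIMSEQ_unique[OF pSS[of "Suc 0", unfolded coin_dist_rec_cases] tendsto_add[OF qSS pS]] .
  have p2: "p (Suc (Suc k)) = q (Suc (Suc k)) / 4 + p (Suc k) - p k / 4" for k
    using LIMSEQ_unique[OF pSS[of "Suc (Suc k)", unfolded coin_dist_rec_cases]
        tendsto_diff[OF tendsto_add[OF qSS pS] tendsto_divide[OF p[of k] tendsto_const[of 4]]]] by simp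
  have p_nonneg: "0 \<le> p k" for k
    by (rule LIMSEQ_le_const[OF p]) (use coin_dist_nonneg in auto)
  have q_nonneg: "0 \<le> q k" for k
    by (rule LIMSEQ_le_const[OF q]) (auto simp: anchored_dist_def missing_dist_def intro!: exI expect_nonneg)
  have q_sum: "(\<Sum>j\<le>k. q j) \<le> 1" for k
    by (rule LIMSEQ_le_const2[OF tendsto_sum[OF q]]) (use anchored_dist_sum_le in auto)
  have "\<delta> \<le> 4 * q 2 - q 0"
    by (rule LIMSEQ_le_const[of "\<lambda>h. 4 * anchored_dist h 2 - anchored_dist h 0"]) (intro tendsto_intros q, use Q20 in auto)
  then have q20: "\<delta> \<le> 4 * q (Suc (Suc 0)) - q 0" by (simp only: numeral_2_eq_2)
  have "4 + \<delta> \<le> 5 * (q 0 + q 1) + 4 * q 2"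
    by (rule LIMSEQ_le_const[of "\<lambda>h. 5 * (anchored_dist h 0 + anchored_dist h 1) + 4 * anchored_dist h 2"])
       (intro tendsto_intros q, use Q012 in auto)
  then have q012: "4 + \<delta> \<le> 5 * (q 0 + q (Suc 0)) + 4 * q (Suc (Suc 0))"
    by (simp only: numeral_2_eq_2 One_nat_def)
  \<comment> \<open>The recursion is summed from \<open>p 3\<close> on. Of the subtracted terms only
    \<open>p 1\<close>, from the first step, is kept.\<close>
  have telescope: "p (Suc (Suc (Suc k))) \<le> p (Suc (Suc 0)) + ((\<Sum>j\<le>Suc (Suc (Suc k)). q j)
      - (q 0 + q (Suc 0) + q (Suc (Suc 0))) - p (Suc 0)) / 4" for k
  proof (induction k)
    case 0
    show ?case using p2[of "Suc 0"] by simp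
  next
    case (Suc k)
    show ?case using Suc p2[of "Suc (Suc k)"] p_nonneg[of "Suc (Suc k)"] by (simp add: field_simps)
  qed
  \<comment> \<open>\<open>p 2 - p 1\<close> equals \<open>(4 q 2 - q 0) / 16\<close>. For indices
    from \<open>3\<close> on, \<open>\<Sum> q \<le> 1\<close> and
    \<open>p 1 = (q 0 + q 1) / 4\<close> turn the telescoped bound into
    \<open>(5 (q 0 + q 1) + 4 q 2 - 4) / 16\<close>.\<close>
  have gap: "p k + \<delta> / 16 \<le> p (Suc (Suc 0))" if "k \<noteq> 2" for k
  proof -
    have p21: "p (Suc 0) + \<delta> / 16 \<le> p (Suc (Suc 0))"
      using p2[of 0] p0 q20 by simp
    consider "k = 0" | "k = Suc 0" | k' where "k = Suc (Suc (Suc k'))"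
      using \<open>k \<noteq> 2\<close> by (metis not0_implies_Suc numeral_2_eq_2)
    then show ?thesis
    proof cases
      case 1
      then show ?thesis using p21 p1 q_nonneg[of "Suc 0"] by simp
    next
      case 2
      then show ?thesis using p21 by simp
    next
      case 3
      show ?thesis
        unfolding 3 using telescope[of k'] q_sum[of "Suc (Suc (Suc k'))"] p0 p1 q012
        by (simp add: field_simps del: sum.atMost_Suc)
    qed
  qed
  \<comment> \<open>The error bound does not depend on \<open>k\<close>, so one \<open>h0\<close>
    serves all \<open>k\<close>. Two errors below \<open>\<delta> / 64\<close> leave
    \<open>\<delta> / 32\<close> of the gap \<open>\<delta> / 16\<close>.\<close>
  have "(\<lambda>h. 4 * (3/4::real) ^ Suc h) \<longlonglongrightarrow> 4 * 0"
    by (intro tendsto_mult tendsto_const LIMSEQ_Suc LIMSEQ_realpow_zero) auto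
  then have "\<forall>\<^sub>F h in sequentially. 4 * (3/4::real) ^ Suc h < \<delta> / 64"
    using assms(1) by (intro order_tendstoD(2)[of _ 0]) auto
  then obtain h0 where h0: "\<And>h. h \<ge> h0 \<Longrightarrow> 4 * (3/4::real) ^ Suc h < \<delta> / 64"
    unfolding eventually_sequentially by blast
  show thesis
  proof (rule that[of "\<delta> / 32" h0])
    show "0 < \<delta> / 32" using assms(1) by simp
    fix h k :: nat assume "h \<ge> h0" "k \<noteq> 2"
    then show "coin_dist h k + \<delta> / 32 \<le> coin_dist h 2"
      using h0[of h] gap[of k] dist[of h k] dist[of h 2] unfolding numeral_2_eq_2 by linarith
  qed
qed

subsection \<open>Difference sets of random subsets\<close>

text \<open>The pairs \<open>{t, g t}\<close> are disjoint, and each excludes one of its four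
  patterns. Denominators are cleared to stay in the naturals.\<close>

lemma card_avoiding_pairs:
  assumes "finite V" "finite T" "T \<subseteq> V" "g ` T \<subseteq> V" "inj_on g T" "T \<inter> g ` T = {}"
  shows "card {S \<in> Pow V. \<forall>x\<in>T. \<not> (x \<in> S \<and> g x \<in> S)} * 4 ^ card T = 3 ^ card T * 2 ^ card V"
  using assms(2,1,3-)
proof (induction T arbitrary: V rule: finite_induct)
  case empty
  have "{S \<in> Pow V. \<forall>x\<in>{}. \<not> (x \<in> S \<and> g x \<in> S)} = Pow V" by auto
  then show ?case using empty by (simp only: card_Pow) simp
next
  case (insert t T)
  define V' where "V' = V - {t, g t}"
  define X where "X = {S \<in> Pow V'. \<forall>x\<in>T. \<not> (x \<in> S \<and> g x \<in> S)}"
  have fresh: "t \<notin> T" "t \<notin> g ` T" "g t \<notin> T" "g t \<notin> g ` T" "t \<noteq> g t"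
    using insert.hyps insert.prems by (auto simp: inj_on_def)
  have g_fresh: "g x \<noteq> g t" if "x \<in> T" for x
    using that fresh(4) by (metis imageI)
  have fin: "finite V'" "finite X"
    using insert.prems unfolding V'_def X_def by auto
  have "card V = card V' + 2"
  proof -
    have "card {t, g t} = 2" "{t, g t} \<subseteq> V" using fresh insert.prems by auto
    then show ?thesis
      unfolding V'_def using insert.prems(1) card_mono[of V "{t, g t}"] by (simp add: card_Diff_subset)
  qed
  moreover have "card X * 4 ^ card T = 3 ^ card T * 2 ^ card V'"
    unfolding X_def using insert.prems fresh fin by (intro insert.IH) (auto simp: V'_def g_fresh)
  moreover have "card {S \<in> Pow V. \<forall>x\<in>insert t T. \<not> (x \<in> S \<and> g x \<in> S)} = 3 * card X"
  proof -
    let ?L = "{S \<in> Pow V. \<forall>x\<in>insert t T. \<not> (x \<in> S \<and> g x \<in> S)}"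
    have X: "t \<notin> S" "g t \<notin> S" if "S \<in> X" for S
      using that unfolding X_def V'_def by auto
    have "?L = X \<union> insert t ` X \<union> insert (g t) ` X"
    proof (intro equalityI subsetI)
      fix S assume S: "S \<in> ?L"
      have m: "S - {t, g t} \<in> X"
        using S unfolding X_def V'_def by auto
      consider "t \<notin> S" "g t \<notin> S" | "t \<in> S" "g t \<notin> S" | "t \<notin> S" "g t \<in> S" using S by auto
      then show "S \<in> X \<union> insert t ` X \<union> insert (g t) ` X"
      proof cases
        case 1
        then have "S - {t, g t} = S" by auto
        then show ?thesis using m by auto
      next
        case 2
        then have "S = insert t (S - {t, g t})" by auto
        then show ?thesis using m by blast
      next
        case 3
        then have "S = insert (g t) (S - {t, g t})" by auto
        then show ?thesis using m by blast
      qed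
    next
      fix S assume "S \<in> X \<union> insert t ` X \<union> insert (g t) ` X"
      then show "S \<in> ?L"
        using fresh insert.prems unfolding X_def V'_def by (auto simp: g_fresh)
    qed
    moreover have "card (insert t ` X) = card X" "card (insert (g t) ` X) = card X"
      by (rule card_image, rule inj_onI, metis X insert_ident)+
    moreover have "X \<inter> insert t ` X = {}" "(X \<union> insert t ` X) \<inter> insert (g t) ` X = {}"
      using X fresh by auto
    ultimately show ?thesis using fin by (simp add: card_Un_disjoint)
  qed
  ultimately show ?case using insert.hyps by (simp add: mult_ac)
qed

lemma card_missing_difference:
  assumes "0 < d" "d < n"
  shows "real (card {S \<in> Pow {0..<int n}. int d \<notin> difference_set S}) \<le> (3/4) ^ ((n - d) div 2) * 2 ^ n"
proof -
  \<comment> \<open>The pairs \<open>{x, x + d}\<close> with \<open>x \<in> T r\<close> are disjoint since \<open>x div d\<close> changes parity.\<close>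
  define T where "T r = {0..<int n - int d} \<inter> {x. even (x div int d) = r}" for r
  have "{0..<int n - int d} = T True \<union> T False" by (auto simp: T_def)
  moreover have "card (T True \<union> T False) = card (T True) + card (T False)"
    by (rule card_Un_disjoint) (auto simp: T_def)
  ultimately have "card {0..<int n - int d} = card (T True) + card (T False)" by simp
  then have "n - d = card (T True) + card (T False)" by simp
  \<comment> \<open>One of the two parity classes holds at least half of the \<open>n - d\<close>
    starting points.\<close>
  then have "(n - d) div 2 \<le> card (T True) \<or> (n - d) div 2 \<le> card (T False)" by linarith
  then obtain r where r: "(n - d) div 2 \<le> card (T r)" by blast
  have par: "even ((x + int d) div int d) = (\<not> even (x div int d))" for x
    using assms(1) by simp
  have eq: "card {S \<in> Pow {0..<int n}. \<forall>x\<in>T r. \<not> (x \<in> S \<and> x + int d \<in> S)} * 4 ^ card (T r)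
      = 3 ^ card (T r) * 2 ^ n"
  proof (subst card_avoiding_pairs)
    show "T r \<inter> (\<lambda>x. x + int d) ` T r = {}"
      unfolding T_def by (auto simp: par)
  qed (auto simp: T_def)
  have "card {S \<in> Pow {0..<int n}. int d \<notin> difference_set S}
      \<le> card {S \<in> Pow {0..<int n}. \<forall>x\<in>T r. \<not> (x \<in> S \<and> x + int d \<in> S)}"
  proof (intro card_mono subsetI)
    fix S assume S: "S \<in> {S \<in> Pow {0..<int n}. int d \<notin> difference_set S}"
    have "\<not> (x \<in> S \<and> x + int d \<in> S)" for x
    proof
      assume "x \<in> S \<and> x + int d \<in> S"
      moreover have "int d = (x + int d) - x" by simp
      ultimately show False using S unfolding difference_set_def by blast
    qed
    then show "S \<in> {S \<in> Pow {0..<int n}. \<forall>x\<in>T r. \<not> (x \<in> S \<and> x + int d \<in> S)}"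
      using S by blast
  qed simp
  then have "real (card {S \<in> Pow {0..<int n}. int d \<notin> difference_set S})
      \<le> real (card {S \<in> Pow {0..<int n}. \<forall>x\<in>T r. \<not> (x \<in> S \<and> x + int d \<in> S)})" by simp
  also have "\<dots> = (3/4) ^ card (T r) * 2 ^ n"
  proof -
    have "real (card {S \<in> Pow {0..<int n}. \<forall>x\<in>T r. \<not> (x \<in> S \<and> x + int d \<in> S)}) * 4 ^ card (T r)
        = 3 ^ card (T r) * 2 ^ n"
      using arg_cong[OF eq, of real] by simp
    then show ?thesis by (simp add: power_divide field_simps)
  qed
  also have "\<dots> \<le> (3/4) ^ ((n - d) div 2) * 2 ^ n"
    using r by (intro mult_right_mono power_decreasing) auto
  finally show ?thesis .
qed

section \<open>Splitting a random subset into its two ends and its middle\<close>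

definition left_part :: "nat \<Rightarrow> int set \<Rightarrow> nat set" where
  "left_part h S = {i. i < h \<and> int i \<in> S}"

definition right_part :: "nat \<Rightarrow> nat \<Rightarrow> int set \<Rightarrow> nat set" where
  "right_part n h S = {i. i < h \<and> int n - 1 - int i \<in> S}"

text \<open>As \<open>2 * h \<le> n\<close>, the two ends do not overlap, and \<open>\<psi>\<close>
  glues \<open>S\<close> from \<open>A\<close>, the mirrored \<open>B\<close> and an arbitrary
  middle \<open>C\<close>. The choice of \<open>C\<close> gives the power of two.\<close>

lemma card_parts:
  assumes "2 * h \<le> n"
  shows "card {S \<in> Pow {0..<int n}. R (left_part h S) (right_part n h S)}
    = card {(A, B). A \<subseteq> {..<h} \<and> B \<subseteq> {..<h} \<and> R A B} * 2 ^ (n - 2 * h)"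
proof -
  define M where "M = {int h..<int n - int h}"
  define \<psi> where "\<psi> = (\<lambda>((A, B), C). int ` A \<union> (\<lambda>i. int n - 1 - int i) ` B \<union> C)"
  let ?L = "{S \<in> Pow {0..<int n}. R (left_part h S) (right_part n h S)}"
  let ?R = "{(A, B). A \<subseteq> {..<h} \<and> B \<subseteq> {..<h} \<and> R A B}"
  have parts: "left_part h (\<psi> ((A, B), C)) = A" "right_part n h (\<psi> ((A, B), C)) = B" "\<psi> ((A, B), C) \<inter> M = C"
    if "A \<subseteq> {..<h}" "B \<subseteq> {..<h}" "C \<subseteq> M" for A B C
  proof -
    have lt: "i < h" if "i \<in> A \<or> i \<in> B" for i
      using that \<open>A \<subseteq> {..<h}\<close> \<open>B \<subseteq> {..<h}\<close> by auto
    have A: "int n - 1 - int i \<notin> int ` A" if "i < h" for i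
    proof
      assume "int n - 1 - int i \<in> int ` A"
      then obtain a where "a \<in> A" "int n - 1 - int i = int a" by blast
      then show False using that lt[of a] assms by simp
    qed
    have B: "int i \<notin> (\<lambda>i. int n - 1 - int i) ` B" if "i < h" for i
    proof
      assume "int i \<in> (\<lambda>i. int n - 1 - int i) ` B"
      then obtain b where "b \<in> B" "int i = int n - 1 - int b" by blast
      then show False using that lt[of b] assms by simp
    qed
    have K: "int i \<notin> M" "int n - 1 - int i \<notin> M" if "i < h" for i
      using that unfolding M_def by simp_all
    have C: "int i \<notin> C" "int n - 1 - int i \<notin> C" if "i < h" for i
      using K[OF that] \<open>C \<subseteq> M\<close> by (meson subsetD)+
    have M: "int ` A \<inter> M = {}" "(\<lambda>i. int n - 1 - int i) ` B \<inter> M = {}"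
    proof -
      have "int i \<notin> M" if "i \<in> A" for i using K(1) lt that by simp
      then show "int ` A \<inter> M = {}" by blast
      have "int n - 1 - int i \<notin> M" if "i \<in> B" for i using K(2) lt that by simp
      then show "(\<lambda>i. int n - 1 - int i) ` B \<inter> M = {}" by blast
    qed
    show "left_part h (\<psi> ((A, B), C)) = A"
    proof (rule set_eqI)
      fix i
      show "i \<in> left_part h (\<psi> ((A, B), C)) \<longleftrightarrow> i \<in> A"
        using A[of i] B[of i] C[of i] lt[of i] by (auto simp: left_part_def \<psi>_def)
    qed
    show "right_part n h (\<psi> ((A, B), C)) = B"
    proof (rule set_eqI)
      fix i
      show "i \<in> right_part n h (\<psi> ((A, B), C)) \<longleftrightarrow> i \<in> B"
        using A[of i] B[of i] C[of i] lt[of i] by (auto simp: right_part_def \<psi>_def)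
    qed
    show "\<psi> ((A, B), C) \<inter> M = C"
      unfolding \<psi>_def using M \<open>C \<subseteq> M\<close> by (simp add: Int_Un_distrib2 Int_absorb2)
  qed
  have recover: "\<psi> ((left_part h S, right_part n h S), S \<inter> M) = S" if "S \<subseteq> {0..<int n}" for S
  proof (intro equalityI subsetI)
    fix x assume "x \<in> \<psi> ((left_part h S, right_part n h S), S \<inter> M)"
    then show "x \<in> S" by (auto simp: \<psi>_def left_part_def right_part_def)
  next
    fix x assume x: "x \<in> S"
    then have bounds: "0 \<le> x" "x < int n" using that by auto
    consider "x < int h" | "x \<in> M" | "int n - int h \<le> x" unfolding M_def by fastforce
    then show "x \<in> \<psi> ((left_part h S, right_part n h S), S \<inter> M)"
    proof cases
      case 1
      then have "nat x \<in> left_part h S" using x bounds by (auto simp: left_part_def)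
      then have "int (nat x) \<in> int ` left_part h S" by (rule imageI)
      then show ?thesis using bounds by (simp add: \<psi>_def)
    next
      case 2
      then show ?thesis using x by (simp add: \<psi>_def)
    next
      case 3
      then have "nat (int n - 1 - x) \<in> right_part n h S" using x bounds by (auto simp: right_part_def)
      then have "int n - 1 - int (nat (int n - 1 - x)) \<in> (\<lambda>i. int n - 1 - int i) ` right_part n h S"
        by (rule imageI)
      then show ?thesis using bounds by (simp add: \<psi>_def)
    qed
  qed
  have bij: "bij_betw \<psi> (?R \<times> Pow M) ?L"
  proof (rule bij_betw_byWitness[where f' = "\<lambda>S. ((left_part h S, right_part n h S), S \<inter> M)"])
    show "\<forall>x\<in>?R \<times> Pow M. ((left_part h (\<psi> x), right_part n h (\<psi> x)), \<psi> x \<inter> M) = x"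
      using parts by auto
    show "\<forall>S\<in>?L. \<psi> ((left_part h S, right_part n h S), S \<inter> M) = S"
      using recover by auto
    show "\<psi> ` (?R \<times> Pow M) \<subseteq> ?L"
    proof (clarify, intro conjI)
      fix A B C assume ABC: "A \<subseteq> {..<h}" "B \<subseteq> {..<h}" "R A B" "C \<subseteq> M"
      have "int ` A \<subseteq> {0..<int n}" "(\<lambda>i. int n - 1 - int i) ` B \<subseteq> {0..<int n}" "C \<subseteq> {0..<int n}"
        using ABC assms by (auto simp: M_def)
      then show "\<psi> ((A, B), C) \<in> Pow {0..<int n}" unfolding \<psi>_def by simp
      show "R (left_part h (\<psi> ((A, B), C))) (right_part n h (\<psi> ((A, B), C)))"
        using parts ABC by simp
    qed
    show "(\<lambda>S. ((left_part h S, right_part n h S), S \<inter> M)) ` ?L \<subseteq> ?R \<times> Pow M"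
      by (auto simp: left_part_def right_part_def)
  qed
  have "card ?L = card (?R \<times> Pow M)" by (rule bij_betw_same_card[OF bij, symmetric])
  also have "\<dots> = card ?R * 2 ^ (n - 2 * h)"
  proof -
    have "card M = n - 2 * h" using assms unfolding M_def card_atLeastLessThan_int by linarith
    then show ?thesis by (simp add: card_cartesian_product card_Pow M_def)
  qed
  finally show ?thesis .
qed

lemma coin_dist_eq_card:
  "coin_dist h k = card {(A, B). A \<subseteq> {..<h} \<and> B \<subseteq> {..<h} \<and> card (missing h A B) = k} / 4 ^ h"
proof -
  have weight: "weight h coin A = 1 / 2 ^ h" for A
  proof -
    have "weight h coin A = (\<Prod>i<h. 1/2)" unfolding weight_def by (intro prod.cong) auto
    then show ?thesis by (simp add: power_divide)
  qed
  have "coin_dist h k = (\<Sum>(A, B)\<in>Pow {..<h} \<times> Pow {..<h}. of_bool (card (missing h A B) = k) / 4 ^ h)"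
    unfolding coin_dist_def missing_dist_def expect_def weight sum.cartesian_product[symmetric]
    by (simp flip: power_mult_distrib)
  also have "\<dots> = (\<Sum>p\<in>Pow {..<h} \<times> Pow {..<h}. of_bool (card (missing h (fst p) (snd p)) = k)) / 4 ^ h"
    unfolding sum_divide_distrib by (rule sum.cong) auto
  also have "(\<Sum>p\<in>Pow {..<h} \<times> Pow {..<h}. of_bool (card (missing h (fst p) (snd p)) = k))
      = real (card {(A, B). A \<subseteq> {..<h} \<and> B \<subseteq> {..<h} \<and> card (missing h A B) = k})"
    by (subst sum_of_bool_eq) (auto intro!: arg_cong[of _ _ card])
  finally show ?thesis .
qed

text \<open>\<open>n - 1 - j = (n - 1 - b) - a\<close> amounts to \<open>a + b = j\<close>, so for
  \<open>j < h\<close> this difference concerns the two ends only. All other positive differences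
  are below \<open>n - h\<close>. The factor \<open>2\<close> comes from the symmetry of the
  difference set.\<close>

lemma missing_differences:
  assumes S: "S \<subseteq> {0..<int n}" and n: "2 * h \<le> n" "0 < n"
    and small: "\<And>d. 0 < d \<Longrightarrow> d < n - h \<Longrightarrow> int d \<in> difference_set S"
    and "h + 1 < n"
  shows "2 * int n - 1 - int (card (difference_set S))
    = 2 * int (card (missing h (left_part h S) (right_part n h S)))"
proof -
  let ?N = "missing h (left_part h S) (right_part n h S)"
  define G where "G = {1..int n - 1} \<inter> difference_set S"
  have fin: "finite G" unfolding G_def by auto
  \<comment> \<open>\<open>h + 1 < n\<close> makes \<open>1\<close> one of the small differences, so
    \<open>S\<close> has an element and \<open>0\<close> is a difference.\<close>
  have ne: "S \<noteq> {}" using small[of 1] assms(5) by (auto simp: difference_set_def less_diff_conv)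
  have diffs: "difference_set S = insert 0 (G \<union> uminus ` G)"
  proof (intro equalityI subsetI)
    fix d assume "d \<in> difference_set S"
    then obtain x y where xy: "x \<in> S" "y \<in> S" "d = x - y" by (auto simp: difference_set_def)
    then have "- d \<in> difference_set S" "d \<in> difference_set S" by (auto simp: difference_set_def)
    moreover have "x \<in> {0..<int n}" "y \<in> {0..<int n}" using S xy by auto
    then have "\<bar>d\<bar> \<le> int n - 1" using xy(3) by auto
    ultimately show "d \<in> insert 0 (G \<union> uminus ` G)"
      unfolding G_def by (cases "0 < d"; cases "d = 0") (auto intro!: image_eqI[of d uminus "- d"])
  next
    fix d assume "d \<in> insert 0 (G \<union> uminus ` G)"
    then consider "d = 0" | "d \<in> difference_set S" | "- d \<in> difference_set S" unfolding G_def by auto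
    then show "d \<in> difference_set S"
    proof cases
      case 1
      then show ?thesis using ne by (auto simp: difference_set_def)
    next
      case 3
      then obtain x y where "x \<in> S" "y \<in> S" "- d = x - y" by (auto simp: difference_set_def)
      moreover from this have "d = y - x" by simp
      ultimately show ?thesis unfolding difference_set_def by blast
    qed
  qed
  have cardD: "card (difference_set S) = 1 + 2 * card G"
  proof -
    have "0 \<notin> G \<union> uminus ` G" "G \<inter> uminus ` G = {}" unfolding G_def by auto
    then show ?thesis unfolding diffs using fin by (simp add: card_Un_disjoint card_image)
  qed
  have key: "j \<in> ?N \<longleftrightarrow> int n - 1 - int j \<notin> difference_set S" if "j < h" for j
  proof
    assume N: "j \<in> ?N"
    show "int n - 1 - int j \<notin> difference_set S"
    proof
      assume "int n - 1 - int j \<in> difference_set S"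
      then obtain x y where xy: "x \<in> S" "y \<in> S" "x - y = int n - 1 - int j"
        by (auto simp: difference_set_def)
      \<comment> \<open>\<open>x \<le> n - 1\<close> forces \<open>y \<le> j\<close>, which places
        \<open>y\<close> in the left end.\<close>
      then have y: "0 \<le> y" "y \<le> int j" using S by force+
      have "nat y \<in> left_part h S" using y xy that by (auto simp: left_part_def)
      moreover have "int n - 1 - int (j - nat y) = x" using y xy by auto
      then have "j - nat y \<in> right_part n h S" using xy that by (auto simp: right_part_def)
      ultimately show False using N y by (auto simp: missing_def dest!: spec[of _ "nat y"])
    qed
  next
    assume no_diff: "int n - 1 - int j \<notin> difference_set S"
    have False if "i \<le> j" "i \<in> left_part h S" "j - i \<in> right_part n h S" for i
    proof -
      have "int n - 1 - int j = (int n - 1 - int (j - i)) - int i" using that(1) by simp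
      then show False
        using that no_diff unfolding difference_set_def left_part_def right_part_def by blast
    qed
    then show "j \<in> ?N" using that by (auto simp: missing_def)
  qed
  have "{1..int n - 1} = G \<union> (\<lambda>j. int n - 1 - int j) ` ?N"
  proof (intro equalityI subsetI)
    fix d assume d: "d \<in> {1..int n - 1}"
    show "d \<in> G \<union> (\<lambda>j. int n - 1 - int j) ` ?N"
    proof (cases "d \<in> difference_set S")
      case True
      then show ?thesis using d by (simp add: G_def)
    next
      case False
      then have "\<not> nat d < n - h" using small[of "nat d"] d by auto
      then have j: "nat (int n - 1 - d) < h" "int n - 1 - int (nat (int n - 1 - d)) = d" using d by auto
      then have "nat (int n - 1 - d) \<in> ?N" using key False by simp
      then show ?thesis using j(2) by (metis UnI2 image_eqI)
    qed
  next
    fix d assume "d \<in> G \<union> (\<lambda>j. int n - 1 - int j) ` ?N"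
    then show "d \<in> {1..int n - 1}" using assms(5) by (auto simp: G_def missing_def)
  qed
  moreover have "G \<inter> (\<lambda>j. int n - 1 - int j) ` ?N = {}"
    using key by (auto simp: G_def missing_def)
  ultimately have "card {1..int n - 1} = card G + card ((\<lambda>j. int n - 1 - int j) ` ?N)"
    using fin by (simp add: card_Un_disjoint)
  also have "card ((\<lambda>j. int n - 1 - int j) ` ?N) = card ?N"
    by (rule card_image) (auto simp: inj_on_def)
  finally have "n - 1 = card G + card ?N" by simp
  then show ?thesis using cardD n by simp
qed

text \<open>The exceptional event, complementary to the hypothesis of
  \<open>missing_differences\<close> at \<open>h = n div 2\<close>.\<close>

definition small_difference_missing :: "nat \<Rightarrow> int set set" where
  "small_difference_missing n = {S \<in> Pow {0..<int n}. \<exists>d. 0 < d \<and> d < n - n div 2 \<and> int d \<notin> difference_set S}"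

text \<open>Union bound over fewer than \<open>n\<close> differences, each with
  \<open>n - d > n div 2\<close>.\<close>

lemma card_small_difference_missing: "real (card (small_difference_missing n)) \<le> real n * (3/4) ^ (n div 2 div 2) * 2 ^ n"
proof -
  let ?B = "\<lambda>d. {S \<in> Pow {0..<int n}. int d \<notin> difference_set S}"
  have "small_difference_missing n = (\<Union>d\<in>{0<..<n - n div 2}. ?B d)" unfolding small_difference_missing_def by auto
  then have "card (small_difference_missing n) \<le> (\<Sum>d\<in>{0<..<n - n div 2}. card (?B d))"
    by (simp add: card_UN_le)
  then have "real (card (small_difference_missing n)) \<le> (\<Sum>d\<in>{0<..<n - n div 2}. real (card (?B d)))"
    by (simp only: of_nat_sum[symmetric] of_nat_le_iff)
  also have "\<dots> \<le> (\<Sum>d\<in>{0<..<n - n div 2}. (3/4) ^ (n div 2 div 2) * 2 ^ n)"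
  proof (rule sum_mono)
    fix d assume d: "d \<in> {0<..<n - n div 2}"
    then have "real (card (?B d)) \<le> (3/4) ^ ((n - d) div 2) * 2 ^ n"
      by (intro card_missing_difference) auto
    also have "\<dots> \<le> (3/4) ^ (n div 2 div 2) * 2 ^ n"
      using d by (intro mult_right_mono power_decreasing div_le_mono) auto
    finally show "real (card (?B d)) \<le> (3/4) ^ (n div 2 div 2) * 2 ^ n" .
  qed
  also have "\<dots> \<le> real n * ((3/4) ^ (n div 2 div 2) * 2 ^ n)"
    unfolding sum_constant by (intro mult_right_mono) auto
  finally show ?thesis by (simp add: mult.assoc)
qed

lemma P_missing_card:
  "P_missing n k = card {S \<in> Pow {0..<int n}. 2 * int n - 1 - int (card (difference_set S)) = int k} / 2 ^ n"
proof -
  have "Pow {0..<int n} \<inter> {S. 2 * int n - 1 - int (card (difference_set S)) = int k}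
      = {S \<in> Pow {0..<int n}. 2 * int n - 1 - int (card (difference_set S)) = int k}" by auto
  then show ?thesis
    unfolding P_missing_def by (subst measure_pmf_of_set) (auto simp: card_Pow)
qed

lemma coin_dist_card:
  assumes "h = n div 2"
  shows "coin_dist h k = card {S \<in> Pow {0..<int n}. card (missing h (left_part h S) (right_part n h S)) = k} / 2 ^ n"
proof -
  have h: "2 * h \<le> n" using assms by simp
  have "(2::real) ^ n = 4 ^ h * 2 ^ (n - 2 * h)"
  proof -
    have "(2::real) ^ n = 2 ^ (2 * h) * 2 ^ (n - 2 * h)" using h by (simp flip: power_add)
    then show ?thesis by (simp add: power_mult)
  qed
  then show ?thesis
    unfolding coin_dist_eq_card card_parts[OF h, of "\<lambda>A B. card (missing h A B) = k"] by simp
qed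

text \<open>Outside the exceptional event the number of missing differences is exactly twice that of
  missing sums. In particular, odd values occur only inside that event.\<close>

lemma P_missing_bounds:
  assumes "h = n div 2" "2 < n"
  shows "coin_dist h k \<le> P_missing n (2 * k) + card (small_difference_missing n) / 2 ^ n"
    and "even j \<Longrightarrow> P_missing n j \<le> coin_dist h (j div 2) + card (small_difference_missing n) / 2 ^ n"
    and "odd j \<Longrightarrow> P_missing n j \<le> card (small_difference_missing n) / 2 ^ n"
proof -
  let ?M = "\<lambda>j. {S \<in> Pow {0..<int n}. 2 * int n - 1 - int (card (difference_set S)) = int j}"
  let ?X = "\<lambda>k. {S \<in> Pow {0..<int n}. card (missing h (left_part h S) (right_part n h S)) = k}"
  have good: "2 * int n - 1 - int (card (difference_set S))
      = 2 * int (card (missing h (left_part h S) (right_part n h S)))"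
    if "S \<in> Pow {0..<int n}" "S \<notin> small_difference_missing n" for S
    using that assms by (intro missing_differences) (auto simp: small_difference_missing_def)
  have fin: "finite (small_difference_missing n)" "finite (?M j)" "finite (?X k)" for j k
    unfolding small_difference_missing_def by auto
  have le: "card C / 2 ^ n \<le> card E / 2 ^ n + (card (small_difference_missing n) / 2 ^ n :: real)"
    if "C \<subseteq> E \<union> small_difference_missing n" "finite E" for C E
  proof -
    have "card C \<le> card E + card (small_difference_missing n)"
      using card_mono[OF _ that(1)] card_Un_le[of E "small_difference_missing n"] that(2) fin(1) by fastforce
    then have "real (card C) \<le> card E + card (small_difference_missing n)" by linarith
    then show ?thesis by (simp add: divide_right_mono flip: add_divide_distrib)
  qed
  have "?X k \<subseteq> ?M (2 * k) \<union> small_difference_missing n"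
  proof
    fix S assume S: "S \<in> ?X k"
    show "S \<in> ?M (2 * k) \<union> small_difference_missing n"
    proof (cases "S \<in> small_difference_missing n")
      case False
      then show ?thesis using good[of S] S by simp
    qed simp
  qed
  from le[OF this fin(2)] show "coin_dist h k \<le> P_missing n (2 * k) + card (small_difference_missing n) / 2 ^ n"
    unfolding P_missing_card coin_dist_card[OF assms(1)] .
  show "P_missing n j \<le> coin_dist h (j div 2) + card (small_difference_missing n) / 2 ^ n" if "even j"
  proof -
    have "?M j \<subseteq> ?X (j div 2) \<union> small_difference_missing n"
    proof
      fix S assume S: "S \<in> ?M j"
      show "S \<in> ?X (j div 2) \<union> small_difference_missing n"
      proof (cases "S \<in> small_difference_missing n")
        case False
        then have "int j = 2 * int (card (missing h (left_part h S) (right_part n h S)))"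
          using good[of S] S by simp
        then have "card (missing h (left_part h S) (right_part n h S)) = j div 2" by linarith
        then show ?thesis using S by simp
      qed simp
    qed
    from le[OF this fin(3)] show ?thesis
      unfolding P_missing_card coin_dist_card[OF assms(1)] .
  qed
  show "P_missing n j \<le> card (small_difference_missing n) / 2 ^ n" if "odd j"
  proof -
    have "?M j \<subseteq> {} \<union> small_difference_missing n"
    proof
      fix S assume S: "S \<in> ?M j"
      show "S \<in> {} \<union> small_difference_missing n"
      proof (rule ccontr)
        assume "S \<notin> {} \<union> small_difference_missing n"
        then have "int j = 2 * int (card (missing h (left_part h S) (right_part n h S)))"
          using good[of S] S by simp
        then show False using that by presburger
      qed
    qed
    from le[OF this] show ?thesis unfolding P_missing_card by simp
  qed
qed

section \<open>From the certificates to the inequalities\<close>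

lemma prob_of_one: "prob_of [Present] = coin(0 := 1)"
  by (auto simp: prob_of_def fun_eq_iff)

lemma known_missing_start: "known_missing h 0 [Present] [Present]"
  by (simp add: known_missing_def)

lemma nval_pow2: "nval (pow2 n) = 2 ^ n"
  by (induction n) simp_all

text \<open>\<open>65\<close> is the list length \<open>1\<close> plus the budget \<open>64\<close>.
  The certified bound is a positive integer, hence at least \<open>1\<close>, which is
  \<open>1 / 2 ^ 40\<close> after rescaling.\<close>

lemma anchored_dist_gap_2_0:
  assumes "65 \<le> h"
  shows "1 / 2 ^ 40 \<le> 4 * anchored_dist h 2 - anchored_dist h 0"
proof -
  let ?f = "\<lambda>x. 4 * of_bool (x = 2) + (- 1) * of_bool (x = 0) :: real"
  have "of_int (lower_bound tangents_2_0 64 0 (pow2 40) [Present] [Present])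
      \<le> nval (pow2 40) * expect h (prob_of [Present]) (prob_of (rev [Present])) (\<lambda>A B. ?f (card (missing h A B)))"
    by (rule lower_bound_sound) (use assms in \<open>auto simp: tangents_2_0_def known_missing_start\<close>)
  also have "\<dots> = 2 ^ 40 * (4 * anchored_dist h 2 + (- 1) * anchored_dist h 0)"
    unfolding expect_add expect_cmult nval_pow2 by (simp add: prob_of_one anchored_dist_def missing_dist_def)
  finally have "of_int (lower_bound tangents_2_0 64 0 (pow2 40) [Present] [Present]) \<le> 2 ^ 40 * (4 * anchored_dist h 2 - anchored_dist h 0)"
    by simp
  moreover have "1 \<le> real_of_int (lower_bound tangents_2_0 64 0 (pow2 40) [Present] [Present])"
    using lower_bound_2_0 by linarith
  ultimately show ?thesis by (simp add: field_simps)
qed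

lemma anchored_dist_gap_012:
  assumes "65 \<le> h"
  shows "4 + 1 / 2 ^ 40 \<le> 5 * (anchored_dist h 0 + anchored_dist h 1) + 4 * anchored_dist h 2"
proof -
  let ?f = "\<lambda>x. 5 * of_bool (x = 0) + (5 * of_bool (x = 1) + 4 * of_bool (x = 2)) :: real"
  have "of_int (lower_bound tangents_012 39 0 (pow2 40) [Present] [Present])
      \<le> nval (pow2 40) * expect h (prob_of [Present]) (prob_of (rev [Present])) (\<lambda>A B. ?f (card (missing h A B)))"
  proof (rule lower_bound_sound)
    fix c y
    show "of_int (fst (tangents_012 c)) - of_int (snd (tangents_012 c)) * real y \<le> ?f (c + y)"
      by (cases y rule: nat.exhaust[case_names 0 Suc]; cases "y - 1"; cases "y - 2")
         (auto simp: tangents_012_def)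
  qed (use assms in \<open>auto simp: tangents_012_def known_missing_start\<close>)
  also have "\<dots> = 2 ^ 40 * (5 * anchored_dist h 0 + (5 * anchored_dist h 1 + 4 * anchored_dist h 2))"
    unfolding expect_add expect_cmult nval_pow2 by (simp add: prob_of_one anchored_dist_def missing_dist_def)
  finally have "of_int (lower_bound tangents_012 39 0 (pow2 40) [Present] [Present])
      \<le> 2 ^ 40 * (5 * (anchored_dist h 0 + anchored_dist h 1) + 4 * anchored_dist h 2)"
    by (simp add: algebra_simps)
  moreover have "2 ^ 42 + 1 \<le> real_of_int (lower_bound tangents_012 39 0 (pow2 40) [Present] [Present])"
  proof -
    have "2 ^ 42 + 1 \<le> lower_bound tangents_012 39 0 (pow2 40) [Present] [Present]"
      using lower_bound_012 by (simp only: add1_zle_eq)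
    then have "real_of_int (2 ^ 42 + 1) \<le> real_of_int (lower_bound tangents_012 39 0 (pow2 40) [Present] [Present])"
      by (simp only: of_int_le_iff)
    then show ?thesis by simp
  qed
  ultimately show ?thesis by (simp add: field_simps)
qed

section \<open>Vanishing of the exceptional event and the final comparison\<close>

lemma card_small_difference_missing_tendsto: "(\<lambda>n. card (small_difference_missing n) / 2 ^ n :: real) \<longlonglongrightarrow> 0"
proof (rule tendsto_sandwich[of "\<lambda>_. 0"])
  show "\<forall>\<^sub>F n in sequentially. card (small_difference_missing n) / 2 ^ n \<le> real n * (3/4) ^ (n div 2 div 2)"
    using card_small_difference_missing by (simp add: divide_le_eq)
  \<comment> \<open>\<open>m\<close> stands for \<open>n div 2 div 2\<close>, for which
    \<open>n \<le> 4 * m + 3\<close>.\<close>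
  have "(\<lambda>m. 4 * (real m * (3/4) ^ m) + 3 * (3/4) ^ m) \<longlonglongrightarrow> 4 * 0 + 3 * (0::real)"
    by (intro tendsto_intros powser_times_n_limit_0 LIMSEQ_realpow_zero) auto
  then have lim: "(\<lambda>m. 4 * (real m * (3/4) ^ m) + 3 * (3/4) ^ m) \<longlonglongrightarrow> (0::real)" by simp
  have "filterlim (\<lambda>n::nat. n div 2 div 2) at_top sequentially"
    unfolding filterlim_at_top eventually_sequentially
  proof (intro allI exI impI)
    fix m n :: nat assume "4 * m \<le> n"
    then show "m \<le> n div 2 div 2" by linarith
  qed
  from filterlim_compose[OF lim this]
  have lim': "(\<lambda>n. 4 * (real (n div 2 div 2) * (3/4) ^ (n div 2 div 2)) + 3 * (3/4) ^ (n div 2 div 2))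
      \<longlonglongrightarrow> (0::real)" .
  show "(\<lambda>n. real n * (3/4) ^ (n div 2 div 2)) \<longlonglongrightarrow> 0"
  proof (rule tendsto_sandwich[OF _ _ tendsto_const[of 0] lim'])
    have "real n * (3/4) ^ (n div 2 div 2) \<le> (4 * real (n div 2 div 2) + 3) * (3/4) ^ (n div 2 div 2)" for n
    proof (rule mult_right_mono)
      have "n \<le> 4 * (n div 2 div 2) + 3" by linarith
      then show "real n \<le> 4 * real (n div 2 div 2) + 3" by linarith
    qed simp
    then show "\<forall>\<^sub>F n in sequentially. real n * (3/4) ^ (n div 2 div 2)
        \<le> 4 * (real (n div 2 div 2) * (3/4) ^ (n div 2 div 2)) + 3 * (3/4) ^ (n div 2 div 2)"
      by (intro always_eventually allI) (simp add: algebra_simps)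
  qed simp
qed auto

theorem theorem1p2:
  shows "\<exists>N::nat. \<forall>n::nat. n > 0 \<longrightarrow> n \<ge> N \<longrightarrow>
           (\<forall>k::nat. k \<noteq> 4 \<longrightarrow> P_missing n 4 > P_missing n k)"
proof -
  obtain \<epsilon> h0 where \<epsilon>: "0 < \<epsilon>" and gap: "\<And>h k. h \<ge> h0 \<Longrightarrow> k \<noteq> 2 \<Longrightarrow> coin_dist h k + \<epsilon> \<le> coin_dist h 2"
    using coin_dist_mode[of "1 / 2 ^ 40" 65, OF _ anchored_dist_gap_2_0 anchored_dist_gap_012] by auto
  have "\<forall>\<^sub>F n in sequentially. card (small_difference_missing n) / 2 ^ n < \<epsilon> / 2"
    using card_small_difference_missing_tendsto \<epsilon> by (intro order_tendstoD(2)[of _ 0]) auto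
  then obtain n0 where n0: "\<And>n. n \<ge> n0 \<Longrightarrow> card (small_difference_missing n) / 2 ^ n < \<epsilon> / 2"
    unfolding eventually_sequentially by blast
  have "P_missing n k < P_missing n 4" if n: "n \<ge> max n0 (2 * h0 + 3)" and k: "k \<noteq> 4" for n k
  proof -
    define h where "h = n div 2"
    have h: "h \<ge> h0" "2 < n" using n by (auto simp: h_def)
    \<comment> \<open>The exceptional event enters twice below, at a total cost of less than
      \<open>\<epsilon>\<close>.\<close>
    have small_difference_missing: "card (small_difference_missing n) / 2 ^ n < \<epsilon> / 2" using n n0 by simp
    have "coin_dist h 2 \<le> P_missing n 4 + card (small_difference_missing n) / 2 ^ n"
      using P_missing_bounds(1)[OF h_def h(2), of 2] by simp
    moreover have "P_missing n k + \<epsilon> \<le> coin_dist h 2 + card (small_difference_missing n) / 2 ^ n"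
    proof (cases "even k")
      case True
      then have "k div 2 \<noteq> 2" using k by auto
      then show ?thesis
        using P_missing_bounds(2)[OF h_def h(2) True] gap[OF h(1), of "k div 2"] by linarith
    next
      case False
      \<comment> \<open>For odd \<open>k\<close> it is enough that
        \<open>\<epsilon> \<le> coin_dist h 2\<close>, which is \<open>gap\<close> at
        \<open>0\<close> combined with nonnegativity.\<close>
      then show ?thesis
        using P_missing_bounds(3)[OF h_def h(2) False] gap[OF h(1), of 0] coin_dist_nonneg[of h 0] by simp
    qed
    ultimately show ?thesis using small_difference_missing by linarith
  qed
  then show ?thesis by blast
qed

end
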